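(* Let $G$ be an abelian group. Let $s_1,s_2,n$ be integers satisfying \[s_2 \geq s_1 \geq \max\left(\sqrt{(s_1+s_2)\log n},\ 2^{48}(\log n)^3-s_2\right),\] and let $m$ be an integer such that \[s_1+s_2\leq m\leq \min\left(\frac{s_1^2}{\log n}, \frac{(s_1+s_2)^2}{2^{48}(\log n)^3}\right).\] Let $\lambda = \min\left(\frac{m}{m-s_1-s_2},\log(s_1+s_2)\right)$ and $\beta = \beta\big(m+2^{8}m^{7/6}(s_1+s_2)^{-1/3}\lambda^{-1/3}\sqrt{\log n}\big)$. Then for any $F_1,F_2\subset G$ with $|F_1|=|F_2|=n$, the number of pairs of sets $(X_1,X_2)$ with $X_1\subset F_1$, $X_2\subset F_2$, $|X_i|=s_i$ and $|X_1+X_2|\leq m$ is at most \[\exp\left(2^{10}m^{1/6}(s_1+s_2)^{2/3}\lambda^{2/3}\sqrt{\log n}\right)\binom{s_1(m+\beta)/(s_1+s_2)}{s_1}\binom{s_2(m+\beta)/(s_1+s_2)}{s_2}.\]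
   Context: For an abelian group $G$ and a positive real $t$, $\beta(t) = \max\{|H| : H \text{ a subgroup of } G,\ |H|\leq t\}$. $X_1+X_2=\{x_1+x_2:x_i\in X_i\}$. Binomial coefficients with non-integer upper argument are the generalized ones, $\binom{x}{k}=x(x-1)\cdots(x-k+1)/k!$. $\log$ is the natural logarithm. *)

theory Defs
  imports Complex_Main "HOL-Library.Set_Algebras"
begin

definition add_subgroup :: "'a::ab_group_add set \<Rightarrow> bool" where
  "add_subgroup H \<longleftrightarrow>
     0 \<in> H \<and> (\<forall>x\<in>H. \<forall>y\<in>H. x + y \<in> H) \<and> (\<forall>x\<in>H. - x \<in> H)"

text \<open>
  The group is the whole type \<open>'a\<close>, passed as a type argument. The condition \<open>finite H\<close> is
  essential, since \<open>card\<close> of an infinite set is 0. For \<open>t \<ge> 1\<close> the trivial subgroup qualifies and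
  the cardinalities are bounded by \<open>t\<close>, so the maximum is attained.
\<close>

definition subgroup_beta :: "'a::ab_group_add itself \<Rightarrow> real \<Rightarrow> nat" where
  "subgroup_beta _ t =
     Max {card H | H :: 'a set. add_subgroup H \<and> finite H \<and> real (card H) \<le> t}"

text \<open>
  The minimum of \<open>m / (m - s\<^sub>1 - s\<^sub>2)\<close> and \<open>log (s\<^sub>1 + s\<^sub>2)\<close>. For \<open>m = s\<^sub>1 + s\<^sub>2\<close> the quotient is
  \<open>+\<infinity>\<close>, so the minimum is the logarithm; the case is split because division by zero yields 0.
\<close>

definition lambda_param :: "nat \<Rightarrow> nat \<Rightarrow> nat \<Rightarrow> real" where
  "lambda_param s1 s2 m =
     (if m = s1 + s2 then ln (real s1 + real s2)
      else min (real m / (real m - real s1 - real s2)) (ln (real s1 + real s2)))"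

end

theory Submission imports Defs "HOL-Library.FuncSet" begin

text \<open>
  Write \<open>S = s1 + s2\<close>, \<open>L = log n\<close> and \<open>\<epsilon> = m\<^bsup>1/6\<^esup> S\<^bsup>-1/3\<^esup> \<lambda>\<^bsup>-1/3\<^esup> L\<^bsup>1/2\<^esup>\<close>. A container
  algorithm maintains sets \<open>A \<subseteq> X1 + X2\<close> and \<open>B1 \<supseteq> X1\<close>, \<open>B2 \<supseteq> X2\<close>. In each round about
  \<open>\<surd>(m / L)\<close> elements of one of the sets \<open>X1\<close>, \<open>X2\<close> and a few elements of the other are revealed,
  and either \<open>A\<close> grows or a container shrinks by a factor \<open>1 - \<Omega>(\<epsilon>\<^sup>2)\<close>. It stops when the containers
  are small or at most \<open>3 \<epsilon>\<^sup>2 |B1| |B2|\<close> of the pairs in \<open>B1 \<times> B2\<close> have their sum outside \<open>A\<close>;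
  all revealed information costs a factor \<open>exp (O(\<epsilon>\<^bsup>-2\<^esup> \<surd>m L\<^bsup>3/2\<^esup>)) = exp (O(\<epsilon> \<lambda> S))\<close>.

  At a terminal state a Pollard-type theorem, proved with the Dyson transform, yields
  \<open>|B1| + |B2| \<le> m + \<beta> + O(\<epsilon> m)\<close>. Hence at most \<open>(m + \<beta> + O(\<epsilon> m) choose S)\<close> pairs remain by
  Vandermonde, and this binomial coefficient is, up to a factor \<open>exp (O(\<epsilon> \<lambda> S))\<close>, the product of the
  two generalized ones.
\<close>

section \<open>A Pollard-type theorem in abelian groups\<close>

definition rep_count :: "'a::ab_group_add set \<Rightarrow> 'a set \<Rightarrow> 'a \<Rightarrow> nat" where
  "rep_count A B z = card {b \<in> B. z - b \<in> A}"

text \<open>For finite \<open>A\<close> and \<open>B\<close> this is Pollard's sum |N_1| + ... +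
  |N_t|, where N_i is the set of elements with at least i representations.\<close>

definition trunc_reps :: "nat \<Rightarrow> 'a::ab_group_add set \<Rightarrow> 'a set \<Rightarrow> nat" where
  "trunc_reps t A B = (\<Sum>z\<in>A + B. min t (rep_count A B z))"

lemma rep_count_eq_0:
  assumes "z \<notin> A + B"
  shows "rep_count A B z = 0"
proof -
  have "z - b \<notin> A" if "b \<in> B" for b
    using assms that set_plus_intro[of "z - b" A b B] by auto
  then have "{b \<in> B. z - b \<in> A} = {}" by blast
  then show ?thesis unfolding rep_count_def by (metis card.empty)
qed

text \<open>Elements outside the sumset contribute nothing, so different pairs can be compared term
  by term over one common index set.\<close>

lemma trunc_reps_superset:
  assumes "finite Z" "A + B \<subseteq> Z"
  shows "(\<Sum>z\<in>Z. min t (rep_count A B z)) = trunc_reps t A B"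
  unfolding trunc_reps_def
  by (rule sum.mono_neutral_right) (use assms in \<open>auto simp: rep_count_eq_0\<close>)

lemma rep_count_le_right: "finite B \<Longrightarrow> rep_count A B z \<le> card B"
  unfolding rep_count_def by (rule card_mono) auto

lemma sum_rep_count:
  assumes "finite A" "finite B" "finite Z"
  shows "(\<Sum>z\<in>Z. rep_count A B z) = card {(a, b). a \<in> A \<and> b \<in> B \<and> a + b \<in> Z}"
proof -
  have count: "rep_count A B z = card {(a, b). a \<in> A \<and> b \<in> B \<and> a + b = z}" for z
    unfolding rep_count_def
    by (rule bij_betw_same_card[of "\<lambda>b. (z - b, b)"], rule bij_betwI[where g = snd])
      (auto simp: algebra_simps)
  have eq: "{(a, b). a \<in> A \<and> b \<in> B \<and> a + b \<in> Z} =
      (\<Union>z\<in>Z. {(a, b). a \<in> A \<and> b \<in> B \<and> a + b = z})"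
    by auto
  have "card (\<Union>z\<in>Z. {(a, b). a \<in> A \<and> b \<in> B \<and> a + b = z}) =
      (\<Sum>z\<in>Z. card {(a, b). a \<in> A \<and> b \<in> B \<and> a + b = z})"
    by (rule card_UN_disjoint[OF assms(3)])
      (auto intro: finite_subset[of _ "A \<times> B"] simp: assms)
  then show ?thesis by (simp add: eq count)
qed

section \<open>The Dyson transform to union and intersection\<close>

text \<open>Representations are sorted by whether \<open>b\<close> lies in \<open>A\<close>. Those
  with \<open>b\<close> in \<open>B - A\<close> and \<open>z - b\<close> in
  \<open>A \<inter> B\<close> get their summands swapped, which makes them representations by
  \<open>A \<union> B\<close> and \<open>A \<inter> B\<close>; only those between
  \<open>A - B\<close> and \<open>B - A\<close> remain.\<close>

lemma rep_count_union_inter: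
  assumes "finite A" "finite B"
  shows "rep_count A B z = rep_count (A \<union> B) (A \<inter> B) z + rep_count (A - B) (B - A) z"
proof -
  let ?P = "{b \<in> A \<inter> B. z - b \<in> A}" and ?Q = "{b \<in> B - A. z - b \<in> A \<inter> B}"
    and ?Q' = "{b \<in> A \<inter> B. z - b \<in> B - A}" and ?R = "{b \<in> B - A. z - b \<in> A - B}"
  have "bij_betw (\<lambda>b. z - b) ?Q ?Q'"
    by (rule bij_betwI[where g = "\<lambda>b. z - b"]) auto
  then have Q: "card ?Q = card ?Q'" by (rule bij_betw_same_card)
  have "{b \<in> B. z - b \<in> A} = ?P \<union> (?Q \<union> ?R)" by auto
  moreover have "card (?P \<union> (?Q \<union> ?R)) = card ?P + card (?Q \<union> ?R)"
    by (rule card_Un_disjoint) (use assms in auto)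
  moreover have "card (?Q \<union> ?R) = card ?Q + card ?R"
    by (rule card_Un_disjoint) (use assms in auto)
  moreover have "{b \<in> A \<inter> B. z - b \<in> A \<union> B} = ?P \<union> ?Q'" by auto
  moreover have "card (?P \<union> ?Q') = card ?P + card ?Q'"
    by (rule card_Un_disjoint) (use assms in auto)
  ultimately show ?thesis using Q unfolding rep_count_def by simp
qed

text \<open>Translation only relabels the sums; it allows \<open>B\<close> to be moved so that it
  meets \<open>A\<close> before the transform is applied.\<close>

lemma trunc_reps_translate:
  fixes A B :: "'a::ab_group_add set"
  shows "trunc_reps t A ((+) e ` B) = trunc_reps t A B"
proof -
  have plus: "A + (+) e ` B = (+) e ` (A + B)"
  proof (intro equalityI subsetI)
    fix x assume "x \<in> A + (+) e ` B"
    then obtain a b where "a \<in> A" "b \<in> B" "x = a + (e + b)" by (auto simp: set_plus_def)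
    then show "x \<in> (+) e ` (A + B)"
      by (intro image_eqI[of _ _ "a + b"]) (auto simp: algebra_simps)
  next
    fix x assume "x \<in> (+) e ` (A + B)"
    then obtain a b where "a \<in> A" "b \<in> B" "x = e + (a + b)" by (auto simp: set_plus_def)
    then have "x = a + (e + b)" by (simp add: algebra_simps)
    then show "x \<in> A + (+) e ` B" using \<open>a \<in> A\<close> \<open>b \<in> B\<close> by auto
  qed
  have "rep_count A ((+) e ` B) (e + z) = rep_count A B z" for z
  proof -
    have "{b \<in> (+) e ` B. e + z - b \<in> A} = (+) e ` {b \<in> B. z - b \<in> A}" by auto
    then show ?thesis unfolding rep_count_def by (simp add: card_image)
  qed
  then show ?thesis unfolding trunc_reps_def plus by (simp add: sum.reindex)
qed

text \<open>For \<open>t \<le> i\<close> the union and intersection part alone suffices. Beyond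
  that, this part has at most \<open>i\<close> representations per sum, so the cap never cuts it: it
  counts in full, as \<open>card (A \<union> B) * i\<close>, and leaves the cap \<open>t - i\<close>
  to the other part.\<close>

lemma trunc_reps_transform:
  assumes fin: "finite A" "finite B" and i: "i = card (A \<inter> B)"
  shows "trunc_reps t A B \<ge> (if t \<le> i then trunc_reps t (A \<union> B) (A \<inter> B)
      else i * (card A + card B - i) + trunc_reps (t - i) (A - B) (B - A))"
proof -
  define Z where "Z = (A \<union> B) + (A \<union> B)"
  have Z: "finite Z" unfolding Z_def using fin by (simp add: finite_set_plus)
  have sub: "A + B \<subseteq> Z" "(A \<union> B) + (A \<inter> B) \<subseteq> Z" "(A - B) + (B - A) \<subseteq> Z"
    unfolding Z_def by (rule set_plus_mono2; blast)+
  note split = rep_count_union_inter[OF fin]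
  show ?thesis
  proof (cases "t \<le> i")
    case True
    have "(\<Sum>z\<in>Z. min t (rep_count (A \<union> B) (A \<inter> B) z)) \<le> (\<Sum>z\<in>Z. min t (rep_count A B z))"
      by (rule sum_mono) (simp add: split)
    then show ?thesis using True trunc_reps_superset[OF Z] sub by simp
  next
    case False
    have rep: "rep_count (A \<union> B) (A \<inter> B) z \<le> i" for z
      unfolding i using rep_count_le_right fin by blast
    have "(\<Sum>z\<in>Z. rep_count (A \<union> B) (A \<inter> B) z) + (\<Sum>z\<in>Z. min (t - i) (rep_count (A - B) (B - A) z))
        \<le> (\<Sum>z\<in>Z. min t (rep_count A B z))"
      unfolding sum.distrib[symmetric]
    proof (rule sum_mono)
      fix z assume "z \<in> Z"
      show "rep_count (A \<union> B) (A \<inter> B) z + min (t - i) (rep_count (A - B) (B - A) z)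
          \<le> min t (rep_count A B z)"
        using rep[of z] False by (simp add: split[of z])
    qed
    moreover have "(\<Sum>z\<in>Z. rep_count (A \<union> B) (A \<inter> B) z) = card (A \<union> B) * i"
    proof -
      have "{(a, b). a \<in> A \<union> B \<and> b \<in> A \<inter> B \<and> a + b \<in> Z} = (A \<union> B) \<times> (A \<inter> B)"
        unfolding Z_def by auto
      then show ?thesis using sum_rep_count[of "A \<union> B" "A \<inter> B" Z] fin Z
        by (simp add: card_cartesian_product i)
    qed
    moreover have "card (A \<union> B) = card A + card B - i"
      using card_Un_Int[OF fin] i by simp
    ultimately show ?thesis using False trunc_reps_superset[OF Z] sub by (simp add: mult.commute)
  qed
qed

text \<open>The subgroup is the stabilizer of \<open>A\<close>: it contains \<open>B - B\<close>, and \<open>A\<close> is a union of its cosets.\<close>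

lemma translates_contained_or_disjoint:
  fixes A B :: "'a::ab_group_add set"
  assumes fin: "finite A" "finite B" and ne: "A \<noteq> {}" "B \<noteq> {}" and t: "t \<le> card B"
    and full: "\<And>a b. a \<in> A \<Longrightarrow> b \<in> B \<Longrightarrow> (+) (a - b) ` B \<subseteq> A"
  obtains H :: "'a set" where "add_subgroup H" "finite H" "card B \<le> card H" "card H \<le> card A"
    "t * card A \<le> trunc_reps t A B"
proof -
  define H where "H = {h. (+) h ` A = A}"
  obtain a0 b0 where a0: "a0 \<in> A" and b0: "b0 \<in> B" using ne by auto
  have "add_subgroup H"
    unfolding add_subgroup_def
  proof (intro conjI ballI)
    show "0 \<in> H" unfolding H_def by simp
  next
    fix x y assume "x \<in> H" "y \<in> H"
    moreover have "(+) (x + y) ` A = (+) x ` (+) y ` A" by (auto simp: image_image algebra_simps)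
    ultimately show "x + y \<in> H" unfolding H_def by simp
  next
    fix x assume "x \<in> H"
    then have "(+) (- x) ` A = (+) (- x) ` (+) x ` A" unfolding H_def by simp
    also have "\<dots> = A" by (simp add: image_image)
    finally show "- x \<in> H" unfolding H_def by simp
  qed
  have HA: "h + a0 \<in> A" if "h \<in> H" for h
    using that a0 unfolding H_def by blast
  have inj: "inj_on (\<lambda>h. h + a0) H" by (auto simp: inj_on_def)
  have im: "(\<lambda>h. h + a0) ` H \<subseteq> A" using HA by auto
  have finH: "finite H" using inj im fin(1) by (rule inj_on_finite)
  have cardH: "card H \<le> card A" using card_inj_on_le[OF inj im fin(1)] .
  have diff: "b - b0 \<in> H" if "b \<in> B" for b
  proof -
    have sub: "(+) (b - b0) ` A \<subseteq> A"
    proof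
      fix x assume "x \<in> (+) (b - b0) ` A"
      then obtain a where "a \<in> A" "x = (a - b0) + b" by (auto simp: algebra_simps)
      then show "x \<in> A" using full[OF _ b0, of a] that by auto
    qed
    \<comment> \<open>A translation of a finite set into itself is onto.\<close>
    have "card ((+) (b - b0) ` A) = card A" by (rule card_image) auto
    then show ?thesis unfolding H_def using card_subset_eq[OF fin(1) sub] by auto
  qed
  have "card B \<le> card H"
    by (rule card_inj_on_le[of "\<lambda>b. b - b0"]) (use diff finH in \<open>auto simp: inj_on_def\<close>)
  moreover have "t * card A \<le> trunc_reps t A B"
  proof -
    \<comment> \<open>At each point of the translate of \<open>A\<close> by \<open>b0\<close>, all
      of \<open>B\<close> gives representations, so the cap \<open>t\<close> is attained.\<close>
    have "min t (rep_count A B z) = t" if z: "z \<in> (+) b0 ` A" for z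
    proof -
      obtain a where a: "a \<in> A" "z = b0 + a" using z by auto
      have "z - b \<in> A" if "b \<in> B" for b
        using full[OF a(1) that] b0 a(2) by (auto simp: algebra_simps image_subset_iff)
      then have "{b \<in> B. z - b \<in> A} = B" by auto
      then show ?thesis using t unfolding rep_count_def by simp
    qed
    then have "(\<Sum>z\<in>(+) b0 ` A. min t (rep_count A B z)) = t * card A"
      by (simp add: card_image)
    moreover have "(\<Sum>z\<in>(+) b0 ` A. min t (rep_count A B z)) \<le> trunc_reps t A B"
      unfolding trunc_reps_def
      by (rule sum_mono2) (use fin b0 in \<open>auto simp: finite_set_plus add.commute[of b0]\<close>)
    ultimately show ?thesis by simp
  qed
  ultimately show ?thesis using that \<open>add_subgroup H\<close> finH cardH by blast
qed

text \<open>Induction on \<open>card B\<close> by passing from \<open>(A, B)\<close> to union and intersection. The bound on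
  \<open>card A + card B\<close> is inherited by all smaller pairs and disposes of stabilizers larger than \<open>T\<close>.\<close>

theorem pollard_subgroup:
  fixes A B :: "'a::ab_group_add set" and T :: real and \<beta> :: nat
  assumes \<beta>: "\<And>H :: 'a set. add_subgroup H \<Longrightarrow> finite H \<Longrightarrow> real (card H) \<le> T \<Longrightarrow> card H \<le> \<beta>"
    and fin: "finite A" "finite B" and "t \<le> card A" "t \<le> card B"
    and "real (card A) + real (card B) \<le> T + \<beta>"
  shows "real t * (real (card A) + real (card B) - real t - real \<beta>) \<le> real (trunc_reps t A B)"
  using assms(2-)
proof (induction "card B" arbitrary: A B t rule: less_induct)
  case less
  show ?case
  proof (cases "t = 0")
    case False
    then have ne: "A \<noteq> {}" "B \<noteq> {}" using less.prems by auto
    show ?thesis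
    proof (cases "\<forall>a\<in>A. \<forall>b\<in>B. (+) (a - b) ` B \<subseteq> A")
      case True
      have full: "\<And>a b. a \<in> A \<Longrightarrow> b \<in> B \<Longrightarrow> (+) (a - b) ` B \<subseteq> A"
        using True by blast
      obtain H :: "'a set" where H: "add_subgroup H" "finite H" "card B \<le> card H" "card H \<le> card A"
          "t * card A \<le> trunc_reps t A B"
        by (rule translates_contained_or_disjoint[OF less.prems(1,2) ne less.prems(4) full])
      \<comment> \<open>\<open>card B\<close> is at most \<open>\<beta>\<close> in both cases: if
        \<open>card H \<le> T\<close>, it is at most \<open>card H\<close>; otherwise
        \<open>card A > T\<close>, and the bound on the sum of the cardinalities leaves less than
        \<open>\<beta>\<close> for \<open>B\<close>.\<close>
      have "real (card A) + real (card B) - real t - real \<beta> \<le> real (card A)"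
        using \<beta>[OF H(1,2)] H(3,4) less.prems(5) by (cases "real (card H) \<le> T") linarith+
      then have "real t * (real (card A) + real (card B) - real t - real \<beta>) \<le> real t * real (card A)"
        by (rule mult_left_mono) simp
      also have "\<dots> \<le> real (trunc_reps t A B)" using H(5) by (metis of_nat_mult of_nat_mono)
      finally show ?thesis .
    next
      case nontriv: False
      then obtain a b where ab: "a \<in> A" "b \<in> B" "\<not> (+) (a - b) ` B \<subseteq> A" by auto
      \<comment> \<open>The translate contains \<open>a\<close>, so it meets \<open>A\<close>, but
        it is not contained in \<open>A\<close>. Hence \<open>0 < i < card B\<close>, and both the
        intersection and \<open>B' - A\<close> are small enough for the induction.\<close>
      define B' where "B' = (+) (a - b) ` B"
      define i where "i = card (A \<inter> B')"
      have B': "finite B'" "card B' = card B" unfolding B'_def using less.prems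
        by (auto simp: card_image)
      have "a \<in> A \<inter> B'" unfolding B'_def using ab by (auto intro: image_eqI[of _ _ b])
      then have i: "i > 0" unfolding i_def using less.prems by (auto simp: card_gt_0_iff)
      have "A \<inter> B' \<subset> B'" using ab unfolding B'_def by blast
      then have iB: "i < card B" unfolding i_def using psubset_card_mono B' by metis
      have iA: "i \<le> card A" unfolding i_def by (rule card_mono) (use less.prems in auto)
      have tr: "trunc_reps t A B = trunc_reps t A B'"
        unfolding B'_def by (simp add: trunc_reps_translate)
      have un: "card (A \<union> B') + i = card A + card B"
        using card_Un_Int[of A B'] B' less.prems i_def by simp
      show ?thesis
      proof (cases "t \<le> i")
        case True
        have "real t * (real (card (A \<union> B')) + real (card (A \<inter> B')) - real t - real \<beta>)
            \<le> real (trunc_reps t (A \<union> B') (A \<inter> B'))"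
          by (rule less.hyps) (use iB i_def True less.prems B' un in auto)
        also have "\<dots> \<le> real (trunc_reps t A B)"
          using trunc_reps_transform[OF less.prems(1) B'(1) i_def, of t] True tr by simp
        finally have "real t * (real (card (A \<union> B')) + real i - real t - real \<beta>) \<le> real (trunc_reps t A B)"
          unfolding i_def .
        moreover have "real (card (A \<union> B')) + real i = real (card A) + real (card B)"
          using un by linarith
        ultimately show ?thesis by simp
      next
        case False
        have cA: "card (A - B') = card A - i" unfolding i_def
          using card_Diff_subset_Int[of A B'] less.prems by simp
        have cB: "card (B' - A) = card B - i" unfolding i_def
          using card_Diff_subset_Int[of B' A] less.prems B' by (simp add: Int_commute)
        have ih: "real (t - i) * (real (card (A - B')) + real (card (B' - A)) - real (t - i) - real \<beta>)
            \<le> real (trunc_reps (t - i) (A - B') (B' - A))"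
          by (rule less.hyps) (use i iB iA cA cB less.prems B' in auto)
        have "i * (card A + card B - i) + trunc_reps (t - i) (A - B') (B' - A) \<le> trunc_reps t A B"
          using trunc_reps_transform[OF less.prems(1) B'(1) i_def, of t] False tr B'(2) by simp
        then have "real (i * (card A + card B - i)) + real (trunc_reps (t - i) (A - B') (B' - A))
            \<le> real (trunc_reps t A B)"
          by linarith
        moreover have "real (i * (card A + card B - i)) = real i * (real (card A) + real (card B) - real i)"
          using iA by (simp add: of_nat_diff)
        \<comment> \<open>The full contribution of the first part and the inductive bound for the
          second together exceed the target by exactly \<open>i * \<beta>\<close>.\<close>
        moreover have "real t * (real (card A) + real (card B) - real t - real \<beta>)
            = real i * (real (card A) + real (card B) - real i)
              + (real t - real i) * ((real (card A) - real i) + (real (card B) - real i) - (real t - real i) - real \<beta>)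
              - real i * real \<beta>"
          by (simp add: algebra_simps)
        moreover have "real i * real \<beta> \<ge> 0" by simp
        moreover have "real (card (A - B')) = real (card A) - real i"
            "real (card (B' - A)) = real (card B) - real i" "real (t - i) = real t - real i"
          using iA iB False cA cB by (simp_all add: of_nat_diff)
        ultimately show ?thesis using ih by (smt (verit, best))
      qed
    qed
  qed simp
qed

section \<open>Supersaturation\<close>

definition missed_pairs :: "'a::ab_group_add set \<Rightarrow> 'a set \<Rightarrow> 'a set \<Rightarrow> ('a \<times> 'a) set" where
  "missed_pairs A B1 B2 = {(x, y). x \<in> B1 \<and> y \<in> B2 \<and> x + y \<notin> A}"

lemma finite_missed_pairs: "finite B1 \<Longrightarrow> finite B2 \<Longrightarrow> finite (missed_pairs A B1 B2)"
  unfolding missed_pairs_def by (rule finite_subset[of _ "B1 \<times> B2"]) auto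

lemma card_missed_pairs_swap: "card (missed_pairs A B2 B1) = card (missed_pairs A B1 B2)"
  by (rule bij_betw_same_card[of prod.swap], rule bij_betwI[where g = prod.swap])
    (auto simp: missed_pairs_def add.commute)

lemma card_missed_pairs_sum:
  assumes "finite B1" "finite B2"
  shows "card (missed_pairs A B1 B2) = (\<Sum>x\<in>B1. card {y \<in> B2. x + y \<notin> A})"
proof -
  have "missed_pairs A B1 B2 = (SIGMA x:B1. {y \<in> B2. x + y \<notin> A})"
    unfolding missed_pairs_def by auto
  then show ?thesis using assms by simp
qed

section \<open>Shrinking a pair without raising the density of missed pairs\<close>

text \<open>Averaging: the counts left after deleting one \<open>x\<close>, summed over all
  \<open>x\<close>, give \<open>card B1 - 1\<close> times the original count. If every deletion
  pushed the density above \<open>c\<close>, the original density would exceed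
  \<open>c\<close>.\<close>

lemma ex_remove_keeping_density:
  fixes c :: real
  assumes fin: "finite B1" "finite B2" and two: "2 \<le> card B1"
    and missed: "real (card (missed_pairs A B1 B2)) \<le> c * real (card B1) * real (card B2)"
  shows "\<exists>x\<in>B1. real (card (missed_pairs A (B1 - {x}) B2)) \<le> c * real (card (B1 - {x})) * real (card B2)"
proof (rule ccontr)
  assume contr: "\<not> ?thesis"
  let ?N = "real (card (missed_pairs A B1 B2))" and ?b = "real (card B1)"
  have ne: "B1 \<noteq> {}" using two by auto
  have drop: "real (card (missed_pairs A (B1 - {x}) B2)) = ?N - real (card {y \<in> B2. x + y \<notin> A})"
    if "x \<in> B1" for x
    using that fin by (simp add: card_missed_pairs_sum sum.remove[of B1 x])
  have "(\<Sum>x\<in>B1. c * (?b - 1) * real (card B2)) < (\<Sum>x\<in>B1. ?N - real (card {y \<in> B2. x + y \<notin> A}))"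
  proof (rule sum_strict_mono[OF fin(1) ne])
    fix x assume x: "x \<in> B1"
    have "real (card (B1 - {x})) = ?b - 1" using x fin two by (simp add: of_nat_diff)
    then show "c * (?b - 1) * real (card B2) < ?N - real (card {y \<in> B2. x + y \<notin> A})"
      using contr x drop[OF x] by (metis not_le)
  qed
  also have "\<dots> = ?b * ?N - ?N"
    using fin by (simp add: sum_subtractf card_missed_pairs_sum)
  finally have "(?b - 1) * (c * ?b * real (card B2)) < (?b - 1) * ?N" by (simp add: algebra_simps)
  moreover have "(?b - 1) * ?N \<le> (?b - 1) * (c * ?b * real (card B2))"
    by (rule mult_left_mono[OF missed]) (use two in simp)
  ultimately show False by simp
qed

text \<open>Points are deleted one at a time from a side with at least two, so neither side is
  exhausted. A prescribed total size is needed to meet the size restriction of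
  \<open>pollard_subgroup\<close>.\<close>

lemma ex_subsets_keeping_density:
  fixes c :: real
  assumes "finite B1" "finite B2" "B1 \<noteq> {}" "B2 \<noteq> {}" "2 \<le> k" "k \<le> card B1 + card B2"
    and "real (card (missed_pairs A B1 B2)) \<le> c * real (card B1) * real (card B2)"
  shows "\<exists>C1 C2. C1 \<subseteq> B1 \<and> C2 \<subseteq> B2 \<and> C1 \<noteq> {} \<and> C2 \<noteq> {} \<and> card C1 + card C2 = k
    \<and> real (card (missed_pairs A C1 C2)) \<le> c * real (card C1) * real (card C2)"
  using assms
proof (induction "card B1 + card B2" arbitrary: B1 B2)
  case 0
  then show ?case by simp
next
  case (Suc l)
  note prems = Suc.prems
  show ?case
  proof (cases "k = card B1 + card B2")
    case True
    then show ?thesis using prems by blast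
  next
    case False
    have pos: "card B1 > 0" "card B2 > 0" using prems by (auto simp: card_gt_0_iff)
    then consider "2 \<le> card B1" | "2 \<le> card B2" using False prems by linarith
    then show ?thesis
    proof cases
      case 1
      obtain x where x: "x \<in> B1"
          "real (card (missed_pairs A (B1 - {x}) B2)) \<le> c * real (card (B1 - {x})) * real (card B2)"
        using ex_remove_keeping_density[OF prems(1,2) 1 prems(7)] by blast
      have c: "card (B1 - {x}) = card B1 - 1" using x prems by simp
      have "B1 - {x} \<noteq> {}"
      proof
        assume "B1 - {x} = {}"
        then have "card (B1 - {x}) = 0" by (metis card.empty)
        then show False using c 1 by simp
      qed
      then have "\<exists>C1 C2. C1 \<subseteq> B1 - {x} \<and> C2 \<subseteq> B2 \<and> C1 \<noteq> {} \<and> C2 \<noteq> {} \<and> card C1 + card C2 = k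
          \<and> real (card (missed_pairs A C1 C2)) \<le> c * real (card C1) * real (card C2)"
        by (intro Suc.hyps(1)) (use prems x(2) c Suc.hyps(2) 1 False in auto)
      then show ?thesis by blast
    next
      case 2
      have "real (card (missed_pairs A B2 B1)) \<le> c * real (card B2) * real (card B1)"
        using prems(7) by (simp add: card_missed_pairs_swap mult_ac)
      from ex_remove_keeping_density[OF prems(2,1) 2 this]
      obtain x where x: "x \<in> B2"
          "real (card (missed_pairs A B1 (B2 - {x}))) \<le> c * real (card B1) * real (card (B2 - {x}))"
        by (auto simp: card_missed_pairs_swap[of A B1] mult_ac)
      have c: "card (B2 - {x}) = card B2 - 1" using x prems by simp
      have "B2 - {x} \<noteq> {}"
      proof
        assume "B2 - {x} = {}"
        then have "card (B2 - {x}) = 0" by (metis card.empty)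
        then show False using c 2 by simp
      qed
      then have "\<exists>C1 C2. C1 \<subseteq> B1 \<and> C2 \<subseteq> B2 - {x} \<and> C1 \<noteq> {} \<and> C2 \<noteq> {} \<and> card C1 + card C2 = k
          \<and> real (card (missed_pairs A C1 C2)) \<le> c * real (card C1) * real (card C2)"
        by (intro Suc.hyps(1)) (use prems x(2) c Suc.hyps(2) 2 False in auto)
      then show ?thesis by blast
    qed
  qed
qed

text \<open>A sum inside \<open>A\<close> contributes at most \<open>t\<close>; the sums outside
  \<open>A\<close> contribute at most all their representations, which are the missed pairs.\<close>

lemma trunc_reps_le:
  assumes "finite A" "finite B1" "finite B2"
  shows "trunc_reps t B1 B2 \<le> t * card A + card (missed_pairs A B1 B2)"
proof -
  let ?Z = "B1 + B2"
  have fin: "finite ?Z" using assms by (simp add: finite_set_plus)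
  have "trunc_reps t B1 B2 = (\<Sum>z\<in>?Z \<inter> A. min t (rep_count B1 B2 z)) + (\<Sum>z\<in>?Z - A. min t (rep_count B1 B2 z))"
    unfolding trunc_reps_def using sum.Int_Diff[OF fin] by blast
  also have "(\<Sum>z\<in>?Z \<inter> A. min t (rep_count B1 B2 z)) \<le> (\<Sum>z\<in>?Z \<inter> A. t)"
    by (rule sum_mono) simp
  also have "\<dots> \<le> t * card A" using assms by (simp add: card_mono mult.commute)
  also have "(\<Sum>z\<in>?Z - A. min t (rep_count B1 B2 z)) \<le> (\<Sum>z\<in>?Z - A. rep_count B1 B2 z)"
    by (rule sum_mono) simp
  also have "\<dots> = card {(a, b). a \<in> B1 \<and> b \<in> B2 \<and> a + b \<in> ?Z - A}"
    by (rule sum_rep_count) (use assms fin in auto)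
  also have "{(a, b). a \<in> B1 \<and> b \<in> B2 \<and> a + b \<in> ?Z - A} = missed_pairs A B1 B2"
    unfolding missed_pairs_def by auto
  finally show ?thesis by simp
qed

text \<open>A pair with sum in \<open>A\<close> is determined by \<open>x\<close> and
  \<open>x + y\<close>.\<close>

lemma card_times_le_missed_pairs:
  assumes "finite A" "finite B1" "finite B2"
  shows "card B1 * card B2 \<le> card B1 * card A + card (missed_pairs A B1 B2)"
proof -
  let ?P = "{(x, y). x \<in> B1 \<and> y \<in> B2 \<and> x + y \<in> A}"
  have "B1 \<times> B2 = ?P \<union> missed_pairs A B1 B2" unfolding missed_pairs_def by auto
  then have "card B1 * card B2 = card (?P \<union> missed_pairs A B1 B2)"
    by (simp flip: card_cartesian_product)
  also have "\<dots> \<le> card ?P + card (missed_pairs A B1 B2)" by (rule card_Un_le)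
  finally have "card B1 * card B2 \<le> card ?P + card (missed_pairs A B1 B2)" .
  moreover have "card ?P \<le> card (B1 \<times> A)"
    by (rule card_inj_on_le[of "\<lambda>(x, y). (x, x + y)"]) (use assms in \<open>auto simp: inj_on_def\<close>)
  ultimately show ?thesis by (simp add: card_cartesian_product)
qed

text \<open>When \<open>B1\<close> is much the smaller set, subgroups do not matter: counting pairs
  gives \<open>card B2\<close> at most \<open>m + \<eta>\<^sup>2 * card B2\<close>, and
  \<open>card B1\<close> is itself below \<open>\<eta>\<^sup>2 * card B2\<close>.\<close>

lemma card_add_le_if_unbalanced:
  fixes \<eta> m :: real
  assumes fin: "finite A" "finite B1" "finite B2" and A: "real (card A) \<le> m"
    and \<eta>: "0 < \<eta>" "\<eta> \<le> 1 / 4" and ne: "B1 \<noteq> {}"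
    and missed: "real (card (missed_pairs A B1 B2)) \<le> \<eta>\<^sup>2 * real (card B1) * real (card B2)"
    and small: "real (card B1) < \<eta> * sqrt (real (card B1) * real (card B2))"
    and k: "real (card B1) + real (card B2) \<le> 4 * m"
  shows "real (card B1) + real (card B2) \<le> m + 2 * \<eta> * m"
proof -
  let ?a = "real (card B1)" and ?b = "real (card B2)"
  have a: "?a > 0" using ne fin by (simp add: card_gt_0_iff)
  have "?a\<^sup>2 < (\<eta> * sqrt (?a * ?b))\<^sup>2" by (rule power_strict_mono[OF small]) auto
  then have "?a * ?a < ?a * (\<eta>\<^sup>2 * ?b)" by (simp add: power_mult_distrib power2_eq_square algebra_simps)
  then have ab: "?a < \<eta>\<^sup>2 * ?b" using a by simp
  have "?a * ?b \<le> ?a * real (card A) + real (card (missed_pairs A B1 B2))"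
    using card_times_le_missed_pairs[OF fin] by (metis of_nat_add of_nat_le_iff of_nat_mult)
  also have "\<dots> \<le> ?a * m + \<eta>\<^sup>2 * ?a * ?b"
    using A missed by (intro add_mono mult_left_mono) auto
  finally have "?a * ?b \<le> ?a * (m + \<eta>\<^sup>2 * ?b)" by (simp add: algebra_simps)
  then have "?b \<le> m + \<eta>\<^sup>2 * ?b" using a by simp
  then have "?a + ?b \<le> m + \<eta>\<^sup>2 * (2 * ?b)" using ab by simp
  also have "\<eta>\<^sup>2 * (2 * ?b) \<le> \<eta>\<^sup>2 * (8 * m)"
    by (rule mult_left_mono) (use k a in auto)
  also have "\<dots> = (8 * \<eta> * m) * \<eta>" by (simp add: power2_eq_square)
  also have "\<dots> \<le> (8 * \<eta> * m) * (1 / 4)"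
    by (rule mult_left_mono) (use \<eta> k a in auto)
  finally show ?thesis by simp
qed

text \<open>Pollard's inequality is applied with \<open>t\<close> near \<open>\<eta>\<close> times
  the geometric mean of the two sizes. It loses \<open>t\<close> on one side and the missed pairs
  divided by \<open>t\<close>, again at most about \<open>t\<close>, on the other; both are
  \<open>O(\<eta> * m)\<close>. If \<open>t\<close> exceeds one of the sizes, the sets are
  unbalanced.\<close>

theorem card_add_le_if_few_missed:
  fixes A B1 B2 :: "'a::ab_group_add set" and \<eta> m T :: real and \<beta> :: nat
  assumes \<beta>: "\<And>H :: 'a set. add_subgroup H \<Longrightarrow> finite H \<Longrightarrow> real (card H) \<le> T \<Longrightarrow> card H \<le> \<beta>"
    and T: "m + 9 * \<eta> * m \<le> T" "T \<le> 2 * m" "real \<beta> \<le> T" and \<eta>: "0 < \<eta>" "\<eta> \<le> 1 / 4" "1 \<le> \<eta> * m"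
    and fin: "finite A" "finite B1" "finite B2" and ne: "B1 \<noteq> {}" "B2 \<noteq> {}"
    and A: "real (card A) \<le> m"
    and missed: "real (card (missed_pairs A B1 B2)) \<le> \<eta>\<^sup>2 * real (card B1) * real (card B2)"
  shows "real (card B1) + real (card B2) \<le> m + \<beta> + 8 * \<eta> * m"
proof (rule ccontr)
  assume contr: "\<not> ?thesis"
  have m: "m \<ge> 4"
  proof -
    have "m > 0" using \<eta> by (intro zero_less_mult_pos[of \<eta> m]) auto
    then have "\<eta> * m \<le> 1 / 4 * m" using \<eta> by (intro mult_right_mono) auto
    then show ?thesis using \<eta> by simp
  qed
  \<comment> \<open>\<open>k\<close> is the least integer above the claimed bound. It stays within
    \<open>T + \<beta>\<close>: the ninth multiple of \<open>\<eta> * m\<close> in \<open>T\<close>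
    pays for the rounding, since \<open>1 \<le> \<eta> * m\<close>.\<close>
  define k where "k = nat \<lfloor>m + \<beta> + 8 * \<eta> * m\<rfloor> + 1"
  have nn: "m + \<beta> + 8 * \<eta> * m \<ge> 4" using m \<eta> by simp
  then have k: "real k > m + \<beta> + 8 * \<eta> * m" "real k \<le> m + \<beta> + 8 * \<eta> * m + 1"
    unfolding k_def by linarith+
  have "k \<le> card B1 + card B2"
    unfolding k_def using contr nn by linarith
  moreover have "2 \<le> k" using k nn by linarith
  ultimately obtain C1 C2 where C: "C1 \<subseteq> B1" "C2 \<subseteq> B2" "C1 \<noteq> {}" "C2 \<noteq> {}" "card C1 + card C2 = k"
      and missedC: "real (card (missed_pairs A C1 C2)) \<le> \<eta>\<^sup>2 * real (card C1) * real (card C2)"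
    using ex_subsets_keeping_density[OF fin(2,3) ne _ _ missed, of k] by blast
  have finC: "finite C1" "finite C2" using C fin finite_subset by auto
  let ?a = "real (card C1)" and ?b = "real (card C2)"
  have ab: "?a + ?b = k" using C(5) by linarith
  have kT: "real k \<le> T + \<beta>" using k T \<eta> by linarith
  have k4: "real k \<le> 4 * m" using kT T by linarith
  define x where "x = \<eta> * sqrt (?a * ?b)"
  have x0: "x \<ge> 0" unfolding x_def using \<eta> by simp
  have sq: "sqrt (?a * ?b) \<le> (?a + ?b) / 2" by (rule arith_geo_mean_sqrt) auto
  have "x \<le> \<eta> * (2 * m)" unfolding x_def
    by (rule mult_left_mono) (use sq ab k4 \<eta> in auto)
  then have xm: "x \<le> 2 * (\<eta> * m)" by simp
  define t where "t = nat \<lceil>x\<rceil>"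
  have "x > 0" unfolding x_def using \<eta> C finC by (simp add: card_gt_0_iff)
  then have t: "real t \<ge> x" "real t \<le> x + 1" "real t > 0" unfolding t_def by linarith+
  have missed_x: "real (card (missed_pairs A C1 C2)) \<le> x * x"
    using missedC unfolding x_def by (simp add: power2_eq_square algebra_simps)
  consider "t \<le> card C1" "t \<le> card C2" | "t > card C1" | "t > card C2" by linarith
  then show False
  proof cases
    case 1
    have "real t * (?a + ?b - real t - real \<beta>) \<le> real (trunc_reps t C1 C2)"
      by (rule pollard_subgroup[OF \<beta> finC 1]) (use ab kT in auto)
    also have "\<dots> \<le> real t * real (card A) + real (card (missed_pairs A C1 C2))"
      using trunc_reps_le[OF fin(1) finC, of t] by (metis of_nat_add of_nat_le_iff of_nat_mult)
    also have "\<dots> \<le> real t * m + real t * x"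
      using missed_x A t x0 mult_right_mono[of x "real t" x]
      by (intro add_mono mult_left_mono) auto
    finally have "real t * (?a + ?b - real t - real \<beta>) \<le> real t * (m + x)" by (simp add: algebra_simps)
    then have "?a + ?b - real t - real \<beta> \<le> m + x" using t by simp
    then show False using ab k t xm \<eta> by linarith
  next
    case 2
    then have "?a < x" unfolding t_def using x0 by linarith
    then have "?a + ?b \<le> m + 2 * \<eta> * m"
      by (intro card_add_le_if_unbalanced[OF fin(1) finC A \<eta>(1,2) C(3) missedC])
        (use x_def ab k4 in auto)
    then show False using ab k \<eta> by linarith
  next
    case 3
    then have "?b < x" unfolding t_def using x0 by linarith
    moreover have "real (card (missed_pairs A C2 C1)) \<le> \<eta>\<^sup>2 * ?b * ?a"
      using missedC by (simp add: card_missed_pairs_swap mult_ac)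
    ultimately have "?b + ?a \<le> m + 2 * \<eta> * m"
      by (intro card_add_le_if_unbalanced[OF fin(1) finC(2,1) A \<eta>(1,2) C(4)])
        (use x_def ab k4 in \<open>auto simp: mult.commute\<close>)
    then show False using ab k \<eta> by linarith
  qed
qed

section \<open>Containers\<close>

text \<open>\<open>A\<close> records the sums known so far. With \<open>A\<close> empty and
  containers \<open>F1\<close>, \<open>F2\<close> this is the set to be counted.\<close>

definition configs ::
    "nat \<Rightarrow> nat \<Rightarrow> nat \<Rightarrow> 'a::ab_group_add set \<Rightarrow> 'a set \<Rightarrow> 'a set \<Rightarrow> ('a set \<times> 'a set) set" where
  "configs s1 s2 m A B1 B2 = {(X1, X2). X1 \<subseteq> B1 \<and> X2 \<subseteq> B2 \<and> card X1 = s1 \<and> card X2 = s2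
     \<and> card (X1 + X2) \<le> m \<and> A \<subseteq> X1 + X2}"

text \<open>A round of the container algorithm replaces \<open>(A, B1, B2)\<close> by \<open>A \<union> (T + U)\<close>,
  \<open>refine_left\<close> and \<open>refine_right\<close>, where \<open>(T, U)\<close> is a small fingerprint.\<close>

definition heavy :: "real \<Rightarrow> 'a::ab_group_add set \<Rightarrow> 'a set \<Rightarrow> 'a set \<Rightarrow> 'a set" where
  "heavy \<kappa> A B1 B2 = {x \<in> B1. \<kappa> * real (card B2) \<le> real (card {y \<in> B2. x + y \<notin> A})}"

text \<open>A full fingerprint, of size \<open>q\<close>, gives no information on the other heavy
  elements. A smaller one contains all heavy elements of \<open>X1\<close>, so the remaining ones
  can be discarded.\<close>

definition refine_left :: "real \<Rightarrow> nat \<Rightarrow> 'a::ab_group_add set \<Rightarrow> 'a set \<Rightarrow> 'a set \<Rightarrow> 'a set \<Rightarrow> 'a set" where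
  "refine_left \<kappa> q A B1 B2 T = (if card T = q then B1 else (B1 - heavy \<kappa> A B1 B2) \<union> T)"

text \<open>Each discarded \<open>y\<close> would give at least \<open>\<kappa> / 2 * q\<close> new
  sums with \<open>T\<close>; maximality of \<open>U\<close> excludes it from \<open>X2\<close>.
  Here \<open>A\<close> is meant to be the already enlarged set of sums.\<close>

definition refine_right :: "real \<Rightarrow> nat \<Rightarrow> 'a::ab_group_add set \<Rightarrow> 'a set \<Rightarrow> 'a set \<Rightarrow> 'a set" where
  "refine_right \<kappa> q A B2 T = {y \<in> B2. real (card {x \<in> T. x + y \<notin> A}) < \<kappa> / 2 * real q}"

lemma finite_configs: "finite B1 \<Longrightarrow> finite B2 \<Longrightarrow> finite (configs s1 s2 m A B1 B2)"
  unfolding configs_def by (rule finite_subset[of _ "Pow B1 \<times> Pow B2"]) auto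

lemma configs_swap: "configs s2 s1 m A B2 B1 = prod.swap ` configs s1 s2 m A B1 B2"
  unfolding configs_def by (auto simp: add.commute image_iff)

lemma card_configs_swap: "card (configs s2 s1 m A B2 B1) = card (configs s1 s2 m A B1 B2)"
  unfolding configs_swap[of s2 s1] by (rule card_image) simp

lemma configs_nonempty_bounds:
  assumes "configs s1 s2 m A B1 B2 \<noteq> {}" "finite B1" "finite B2"
  shows "s1 \<le> card B1" "s2 \<le> card B2" "card A \<le> m"
proof -
  obtain X1 X2 where X: "X1 \<subseteq> B1" "X2 \<subseteq> B2" "card X1 = s1" "card X2 = s2"
      "card (X1 + X2) \<le> m" "A \<subseteq> X1 + X2"
    using assms(1) unfolding configs_def by auto
  show "s1 \<le> card B1" "s2 \<le> card B2" using X assms card_mono by metis+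
  have "finite (X1 + X2)" using X assms finite_subset finite_set_plus by metis
  then show "card A \<le> m" using X card_mono le_trans by metis
qed

text \<open>The fingerprint \<open>(T, U)\<close> of a pair: \<open>T\<close> consists of at most \<open>q\<close> heavy elements of \<open>X1\<close>, and
  \<open>U\<close> is a maximal subset of \<open>X2\<close> each of whose elements contributed many new sums with \<open>T\<close>;
  by maximality no element of \<open>X2\<close> can contribute many more.\<close>

lemma ex_fingerprint:
  fixes A B1 B2 :: "'a::ab_group_add set"
  assumes X: "(X1, X2) \<in> configs s1 s2 m A B1 B2" and fin: "finite A" "finite B1" "finite B2"
    and \<kappa>: "\<kappa> > 0" and q: "q > 0"
  shows "\<exists>T U. T \<subseteq> heavy \<kappa> A B1 B2 \<and> card T \<le> q \<and> U \<subseteq> B2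
    \<and> real (card A) + \<kappa> / 2 * real q * real (card U) \<le> real (card (A \<union> (T + U)))
    \<and> (X1, X2) \<in> configs s1 s2 m (A \<union> (T + U)) (refine_left \<kappa> q A B1 B2 T)
        (refine_right \<kappa> q (A \<union> (T + U)) B2 T)"
proof -
  have X': "X1 \<subseteq> B1" "X2 \<subseteq> B2" "card X1 = s1" "card X2 = s2"
      "card (X1 + X2) \<le> m" "A \<subseteq> X1 + X2"
    using X unfolding configs_def by auto
  define D where "D = heavy \<kappa> A B1 B2"
  have "\<exists>T. T \<subseteq> X1 \<inter> D \<and> (card T = q \<or> card T < q \<and> T = X1 \<inter> D)"
  proof (cases "q \<le> card (X1 \<inter> D)")
    case True
    then show ?thesis using obtain_subset_with_card_n by metis
  qed auto
  then obtain T where T: "T \<subseteq> X1 \<inter> D" "card T = q \<or> card T < q \<and> T = X1 \<inter> D" by blast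
  have finX: "finite X1" "finite X2" using X' fin finite_subset by auto
  have finT: "finite T" using T finX finite_subset by auto
  \<comment> \<open>On average each element of \<open>U\<close> has to enlarge the known sums by
    \<open>\<kappa> / 2 * q\<close>; this later limits the total size of all the sets
    \<open>U\<close>.\<close>
  define P where "P U \<longleftrightarrow> real (card A) + \<kappa> / 2 * real q * real (card U) \<le> real (card (A \<union> (T + U)))" for U
  have "finite {U. U \<subseteq> X2 \<and> P U}" by (rule finite_subset[of _ "Pow X2"]) (use finX in auto)
  moreover have "{} \<in> {U. U \<subseteq> X2 \<and> P U}" unfolding P_def by simp
  ultimately obtain U where U: "U \<subseteq> X2" "P U" and max: "\<And>V. V \<subseteq> X2 \<Longrightarrow> P V \<Longrightarrow> U \<subseteq> V \<Longrightarrow> U = V"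
  proof -
    assume fin: "finite {U. U \<subseteq> X2 \<and> P U}" and ne: "{} \<in> {U. U \<subseteq> X2 \<and> P U}"
    assume that: "\<And>U. U \<subseteq> X2 \<Longrightarrow> P U \<Longrightarrow> (\<And>V. V \<subseteq> X2 \<Longrightarrow> P V \<Longrightarrow> U \<subseteq> V \<Longrightarrow> U = V) \<Longrightarrow> thesis"
    have "{U. U \<subseteq> X2 \<and> P U} \<noteq> {}" using ne by blast
    from finite_has_maximal[OF fin this] obtain U where "U \<subseteq> X2" "P U"
        "\<forall>V\<in>{U. U \<subseteq> X2 \<and> P U}. U \<subseteq> V \<longrightarrow> U = V"
      by auto
    then show thesis by (intro that[of U]) auto
  qed
  define A' where "A' = A \<union> (T + U)"
  have finU: "finite U" using U finX finite_subset by auto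
  have finA': "finite A'" unfolding A'_def using fin finT finU by (simp add: finite_set_plus)
  have "real (card {x \<in> T. x + y \<notin> A'}) < \<kappa> / 2 * real q" if y: "y \<in> X2" for y
  proof (rule ccontr)
    assume contr: "\<not> ?thesis"
    let ?E = "(\<lambda>x. x + y) ` {x \<in> T. x + y \<notin> A'}"
    have cE: "card ?E = card {x \<in> T. x + y \<notin> A'}" by (rule card_image) (auto simp: inj_on_def)
    have "y \<notin> U"
    proof
      assume "y \<in> U"
      then have "{x \<in> T. x + y \<notin> A'} = {}" unfolding A'_def by auto
      then have "card {x \<in> T. x + y \<notin> A'} = 0" by (metis card.empty)
      then show False using contr \<kappa> q by simp
    qed
    have "A' \<union> ?E \<subseteq> A \<union> (T + insert y U)" unfolding A'_def by (auto elim!: set_plus_elim)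
    moreover have "finite (A \<union> (T + insert y U))" using fin finT finU by (simp add: finite_set_plus)
    ultimately have "card (A' \<union> ?E) \<le> card (A \<union> (T + insert y U))" by (intro card_mono)
    moreover have "card (A' \<union> ?E) = card A' + card ?E"
      by (rule card_Un_disjoint) (use finA' finT in auto)
    ultimately have "real (card A') + \<kappa> / 2 * real q \<le> real (card (A \<union> (T + insert y U)))"
      using contr cE by linarith
    moreover have "real (card A) + \<kappa> / 2 * real q * real (card U) \<le> real (card A')"
      using U(2) unfolding P_def A'_def .
    moreover have "\<kappa> / 2 * real q * real (card (insert y U))
        = \<kappa> / 2 * real q * real (card U) + \<kappa> / 2 * real q"
      using \<open>y \<notin> U\<close> finU by (simp add: algebra_simps add_divide_distrib)
    ultimately have "P (insert y U)" unfolding P_def by linarith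
    then show False using max[of "insert y U"] U(1) y \<open>y \<notin> U\<close> by blast
  qed
  then have "X2 \<subseteq> refine_right \<kappa> q A' B2 T" unfolding refine_right_def using X' by auto
  moreover have "X1 \<subseteq> refine_left \<kappa> q A B1 B2 T"
    unfolding refine_left_def D_def[symmetric] using X' T by auto
  moreover have "A' \<subseteq> X1 + X2"
    unfolding A'_def using X' U(1) T(1) by (auto elim!: set_plus_elim)
  ultimately have "(X1, X2) \<in> configs s1 s2 m A' (refine_left \<kappa> q A B1 B2 T) (refine_right \<kappa> q A' B2 T)"
    unfolding configs_def using X' by auto
  then show ?thesis using T U X' unfolding P_def A'_def D_def
    by (intro exI[of _ T] exI[of _ U]) auto
qed

section \<open>Progress of a round, measured by a potential\<close>

text \<open>Division by \<open>\<mu>\<close> makes growth of \<open>A\<close> comparable with the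
  relative shrinkage of a container larger than \<open>\<mu>\<close>. While configurations of
  nonempty sets remain, the potential is nonnegative for positive \<open>\<mu>\<close>, so a fixed
  decrease per round bounds the number of rounds.\<close>

definition potential :: "real \<Rightarrow> nat \<Rightarrow> 'a set \<Rightarrow> 'a set \<Rightarrow> 'a set \<Rightarrow> real" where
  "potential \<mu> m A B1 B2 = ln (real (card B1)) + ln (real (card B2)) + (real m - real (card A)) / \<mu>"

lemma refine_missed:
  assumes "finite B2" "finite T"
  shows "real (card (missed_pairs A T (refine_right \<kappa> q A B2 T)))
    \<le> \<kappa> / 2 * real q * real (card (refine_right \<kappa> q A B2 T))"
proof -
  let ?R = "refine_right \<kappa> q A B2 T"
  have fin: "finite ?R" unfolding refine_right_def using assms by simp
  have "card (missed_pairs A T ?R) = (\<Sum>y\<in>?R. card {x \<in> T. y + x \<notin> A})"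
    unfolding card_missed_pairs_swap[of A T ?R] by (rule card_missed_pairs_sum[OF fin assms(2)])
  then have "real (card (missed_pairs A T ?R)) = (\<Sum>y\<in>?R. real (card {x \<in> T. x + y \<notin> A}))"
    by (simp add: add.commute)
  also have "\<dots> \<le> (\<Sum>y\<in>?R. \<kappa> / 2 * real q)"
    by (rule sum_mono) (auto simp: refine_right_def)
  finally show ?thesis by (simp add: mult_ac)
qed

text \<open>The \<open>q\<close> heavy elements of \<open>T\<close> each missed a share of at least
  \<open>\<kappa>\<close> of \<open>B2\<close>. Such a \<open>y\<close> is removed, or has its sum
  newly in \<open>A'\<close>, or still gives a missed pair; the last kind accounts for at most
  \<open>\<kappa> / 2 * card B2\<close> on average over \<open>T\<close>. Removal and growth must
  supply the rest.\<close>

lemma progress_full_fingerprint: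
  fixes A B1 B2 :: "'a::ab_group_add set"
  assumes fin: "finite A" "finite A'" "finite B1" "finite B2"
    and T: "T \<subseteq> heavy \<kappa> A B1 B2" "card T = q" and q: "q > 0" and \<kappa>: "\<kappa> > 0" and AA': "A \<subseteq> A'"
    and \<mu>: "0 < \<mu>" "\<mu> < real (card B2)" and B2': "B2' = refine_right \<kappa> q A' B2 T" "B2' \<noteq> {}"
  shows "potential \<mu> m A' B1 B2' \<le> potential \<mu> m A B1 B2 - \<kappa> / 2"
proof -
  let ?b = "real (card B2)" and ?b' = "real (card B2')"
  have sub: "B2' \<subseteq> B2" unfolding B2' refine_right_def by auto
  have fin': "finite B2'" using sub fin finite_subset by auto
  have finT: "finite T" using T fin finite_subset unfolding heavy_def by (metis (lifting) card_ge_0_finite q)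
  have b': "?b' > 0" using B2' fin' by (simp add: card_gt_0_iff)
  have bb: "?b' \<le> ?b" using card_mono[OF fin(4) sub] by simp
  have AA: "real (card A) \<le> real (card A')" using card_mono[OF fin(2) AA'] by simp
  have "real q * (\<kappa> * ?b) = (\<Sum>x\<in>T. \<kappa> * ?b)" using T by simp
  also have "\<dots> \<le> (\<Sum>x\<in>T. real (card {y \<in> B2. x + y \<notin> A}))"
    by (rule sum_mono) (use T in \<open>auto simp: heavy_def\<close>)
  also have "\<dots> \<le> (\<Sum>x\<in>T. (?b - ?b') + (real (card A') - real (card A)) + real (card {y \<in> B2'. x + y \<notin> A'}))"
  proof (rule sum_mono)
    fix x assume "x \<in> T"
    let ?E = "{y \<in> B2. x + y \<in> A' - A}"
    have "{y \<in> B2. x + y \<notin> A} \<subseteq> (B2 - B2') \<union> (?E \<union> {y \<in> B2'. x + y \<notin> A'})" by auto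
    then have "card {y \<in> B2. x + y \<notin> A} \<le> card ((B2 - B2') \<union> (?E \<union> {y \<in> B2'. x + y \<notin> A'}))"
      by (intro card_mono) (use fin fin' in auto)
    also have "\<dots> \<le> card (B2 - B2') + (card ?E + card {y \<in> B2'. x + y \<notin> A'})"
      by (meson add_mono card_Un_le le_refl le_trans)
    finally have "real (card {y \<in> B2. x + y \<notin> A})
        \<le> real (card (B2 - B2')) + real (card ?E) + real (card {y \<in> B2'. x + y \<notin> A'})"
      by linarith
    moreover have "card ?E \<le> card (A' - A)"
      by (rule card_inj_on_le[of "\<lambda>y. x + y"]) (use fin in \<open>auto simp: inj_on_def\<close>)
    moreover have "real (card (A' - A)) = real (card A') - real (card A)"
      using card_Diff_subset[OF fin(1) AA'] AA by (simp add: of_nat_diff)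
    moreover have "real (card (B2 - B2')) = ?b - ?b'"
      using card_Diff_subset[OF fin' sub] bb by (simp add: of_nat_diff)
    ultimately show "real (card {y \<in> B2. x + y \<notin> A})
        \<le> (?b - ?b') + (real (card A') - real (card A)) + real (card {y \<in> B2'. x + y \<notin> A'})"
      by linarith
  qed
  also have "\<dots> = real q * ((?b - ?b') + (real (card A') - real (card A))) + real (card (missed_pairs A' T B2'))"
    unfolding sum.distrib using T finT fin' by (simp add: card_missed_pairs_sum distrib_left)
  also have "\<dots> \<le> real q * ((?b - ?b') + (real (card A') - real (card A))) + \<kappa> / 2 * real q * ?b'"
    using refine_missed[OF fin(4) finT] unfolding B2'(1) by auto
  also have "\<dots> \<le> real q * ((?b - ?b') + (real (card A') - real (card A)) + \<kappa> / 2 * ?b)"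
    using bb \<kappa> q by (simp add: algebra_simps mult_left_mono)
  finally have "\<kappa> * ?b \<le> (?b - ?b') + (real (card A') - real (card A)) + \<kappa> / 2 * ?b"
    using q by simp
  then have "\<kappa> / 2 * ?b \<le> (?b - ?b') + (real (card A') - real (card A))" by (simp add: field_simps)
  then have "\<kappa> / 2 \<le> ((?b - ?b') + (real (card A') - real (card A))) / ?b"
    using \<mu> by (subst pos_le_divide_eq) auto
  also have "\<dots> = (1 - ?b' / ?b) + (real (card A') - real (card A)) / ?b"
    using \<mu> by (simp add: field_simps)
  \<comment> \<open>\<open>ln x \<le> x - 1\<close> turns the relative shrinkage into a drop of the
    logarithm.\<close>
  also have "1 - ?b' / ?b \<le> ln ?b - ln ?b'"
  proof -
    have "ln (?b' / ?b) \<le> ?b' / ?b - 1" using \<mu> b' by (intro ln_le_minus_one) auto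
    then show ?thesis using \<mu> b' by (simp add: ln_div)
  qed
  also have "(real (card A') - real (card A)) / ?b \<le> (real (card A') - real (card A)) / \<mu>"
    using \<mu> AA by (intro divide_left_mono) auto
  finally show ?thesis unfolding potential_def diff_divide_distrib by linarith
qed

text \<open>Missed pairs now come from light elements of \<open>B1\<close>, at most
  \<open>\<kappa>\<close> times the old product of sizes, or from \<open>T\<close>, at most
  \<open>\<kappa> / 2\<close> times the new product. If the product shrank by at most a factor 2,
  few pairs are missed; otherwise its logarithm dropped by at least \<open>ln 2\<close>, hence by
  \<open>\<kappa> / 2\<close>.\<close>

lemma progress_small_fingerprint:
  fixes A B1 B2 :: "'a::ab_group_add set"
  assumes fin: "finite A" "finite A'" "finite B1" "finite B2"
    and T: "T \<subseteq> heavy \<kappa> A B1 B2" and q: "q \<le> card B1'" and \<kappa>: "0 < \<kappa>" "\<kappa> \<le> 1" and AA': "A \<subseteq> A'"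
    and \<mu>: "0 < \<mu>" and B2': "B2' = refine_right \<kappa> q A' B2 T" "B2' \<noteq> {}"
    and B1': "B1' = (B1 - heavy \<kappa> A B1 B2) \<union> T" "B1' \<noteq> {}"
  shows "real (card (missed_pairs A' B1' B2')) \<le> 3 * \<kappa> * real (card B1') * real (card B2')
    \<or> potential \<mu> m A' B1' B2' \<le> potential \<mu> m A B1 B2 - \<kappa> / 2"
proof -
  let ?a = "real (card B1)" and ?a' = "real (card B1')"
  let ?b = "real (card B2)" and ?b' = "real (card B2')"
  define D where "D = heavy \<kappa> A B1 B2"
  have DB: "D \<subseteq> B1" unfolding D_def heavy_def by auto
  have TD: "T \<subseteq> D" using T unfolding D_def .
  have sub: "B2' \<subseteq> B2" "B1' \<subseteq> B1" using DB TD unfolding B1' B2' refine_right_def D_def[symmetric] by auto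
  have fin': "finite B2'" "finite B1'" "finite T" "finite (B1 - D)" using sub fin TD DB finite_subset by (blast, blast, metis, blast)
  have pos: "?a' > 0" "?b' > 0" using B1'(2) B2'(2) fin' by (auto simp: card_gt_0_iff)
  have mono: "?a' \<le> ?a" "?b' \<le> ?b" using card_mono fin sub by (auto simp: card_mono)
  have AA: "real (card A) \<le> real (card A')" using card_mono[OF fin(2) AA'] by simp
  have "missed_pairs A' B1' B2' \<subseteq> missed_pairs A (B1 - D) B2 \<union> missed_pairs A' T B2'"
    unfolding missed_pairs_def using AA' sub B1'(1) unfolding D_def by auto
  then have "card (missed_pairs A' B1' B2') \<le> card (missed_pairs A (B1 - D) B2 \<union> missed_pairs A' T B2')"
    by (intro card_mono) (use fin fin' in \<open>auto simp: finite_missed_pairs\<close>)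
  also have "\<dots> \<le> card (missed_pairs A (B1 - D) B2) + card (missed_pairs A' T B2')"
    by (rule card_Un_le)
  finally have "real (card (missed_pairs A' B1' B2'))
      \<le> real (card (missed_pairs A (B1 - D) B2)) + real (card (missed_pairs A' T B2'))"
    by linarith
  also have "real (card (missed_pairs A (B1 - D) B2)) = (\<Sum>x\<in>B1 - D. real (card {y \<in> B2. x + y \<notin> A}))"
    using fin by (simp add: card_missed_pairs_sum)
  also have "\<dots> \<le> (\<Sum>x\<in>B1 - D. \<kappa> * ?b)"
    by (rule sum_mono) (auto simp: D_def heavy_def)
  also have "\<dots> \<le> \<kappa> * (?a * ?b)"
    using \<kappa> fin card_mono[of B1 "B1 - D"] by (simp add: mult_right_mono)
  also have "real (card (missed_pairs A' T B2')) \<le> \<kappa> / 2 * real q * ?b'"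
    unfolding B2'(1) by (rule refine_missed) (use fin fin' in auto)
  also have "\<dots> \<le> \<kappa> / 2 * ?a' * ?b'"
    using q \<kappa> by (intro mult_right_mono mult_left_mono) auto
  finally have missed: "real (card (missed_pairs A' B1' B2')) \<le> \<kappa> * (?a * ?b) + \<kappa> / 2 * ?a' * ?b'" by simp
  show ?thesis
  proof (cases "?a * ?b \<le> 2 * (?a' * ?b')")
    case True
    have "\<kappa> * (?a * ?b) \<le> \<kappa> * (2 * (?a' * ?b'))" using True \<kappa> by (intro mult_left_mono) auto
    moreover have "\<kappa> * (?a' * ?b') \<ge> 0" using \<kappa> by simp
    ultimately have "real (card (missed_pairs A' B1' B2')) \<le> 3 * \<kappa> * ?a' * ?b'"
      using missed by (simp add: algebra_simps)
    then show ?thesis ..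
  next
    case False
    have "ln (2 * (?a' * ?b')) \<le> ln (?a * ?b)"
      using False pos mono by (subst ln_le_cancel_iff) auto
    then have "ln 2 + ln ?a' + ln ?b' \<le> ln ?a + ln ?b"
      using pos mono by (simp add: ln_mult)
    moreover have "ln 2 \<ge> (1 / 2 :: real)" using exp_half_le2 by (subst ln_ge_iff) auto
    moreover have "(real m - real (card A')) / \<mu> \<le> (real m - real (card A)) / \<mu>"
      using AA \<mu> by (intro divide_right_mono) auto
    ultimately have "potential \<mu> m A' B1' B2' \<le> potential \<mu> m A B1 B2 - \<kappa> / 2"
      unfolding potential_def using \<kappa> by linarith
    then show ?thesis ..
  qed
qed

section \<open>Counting by fingerprints and recursion\<close>

text \<open>The sum equals \<open>(1 + 1 / N) ^ card B\<close>, at most \<open>exp (1 / 2)\<close>.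
  A union bound over all subsets \<open>U\<close> thus costs only a factor 2 when the bound for
  \<open>U\<close> carries the weight \<open>1 / N ^ card U\<close>.\<close>

lemma sum_Pow_inverse_power_le:
  fixes N :: real
  assumes "finite B" "2 * real (card B) \<le> N" "N > 0"
  shows "(\<Sum>U\<in>Pow B. 1 / N ^ card U) \<le> 2"
proof -
  have "(\<Sum>U\<in>Pow B. 1 / N ^ card U) = (\<Sum>U\<in>Pow B. (\<Prod>x\<in>U. 1 / N) * (\<Prod>x\<in>B - U. 1))"
    by (simp add: power_one_over)
  also have "\<dots> = (\<Prod>x\<in>B. 1 / N + 1)" using assms(1) by (rule prod_add[symmetric])
  also have "\<dots> = (1 + 1 / N) ^ card B" by (simp add: add.commute)
  also have "\<dots> \<le> exp (1 / N) ^ card B" using assms by (intro power_mono) auto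
  also have "\<dots> = exp (real (card B) / N)" by (simp add: exp_of_nat_mult[symmetric])
  also have "\<dots> \<le> exp (1 / 2)" using assms by (simp add: field_simps)
  also have "\<dots> \<le> 2" by (rule exp_half_le2)
  finally show ?thesis .
qed

text \<open>Union bound over fingerprints. The weight in \<open>refined\<close> pays for the choice
  of \<open>U\<close> up to a factor 2, the choice of \<open>T\<close> costs
  \<open>2 * N ^ q\<close>, and the resulting 4 is absorbed in one more \<open>N\<close>.\<close>

lemma container_round:
  fixes A B1 B2 :: "'a::ab_group_add set" and N V \<kappa> \<mu> :: real
  assumes fin: "finite A" "finite B1" "finite B2"
    and N: "4 \<le> N" "2 * real (card B1) \<le> N" "2 * real (card B2) \<le> N" and V: "0 \<le> V"
    and \<kappa>: "0 < \<kappa>" "\<kappa> \<le> 1" and q: "0 < q" "q \<le> s1" "0 < s2" and \<mu>: "0 < \<mu>" "\<mu> < real (card B2)"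
    and refined: "\<And>A' B1' B2' u. finite A' \<Longrightarrow> B1' \<subseteq> B1 \<Longrightarrow> B2' \<subseteq> B2 \<Longrightarrow> configs s1 s2 m A' B1' B2' \<noteq> {}
      \<Longrightarrow> real (card A) + \<kappa> / 2 * real q * real u \<le> real (card A')
      \<Longrightarrow> real (card (missed_pairs A' B1' B2')) \<le> 3 * \<kappa> * real (card B1') * real (card B2')
         \<or> potential \<mu> m A' B1' B2' \<le> potential \<mu> m A B1 B2 - \<kappa> / 2
      \<Longrightarrow> real (card (configs s1 s2 m A' B1' B2')) \<le> V / N ^ u"
  shows "real (card (configs s1 s2 m A B1 B2)) \<le> V * N ^ (q + 1)"
proof -
  \<comment> \<open>Pairs that are no possible fingerprint get the empty set, so the union may run
    over all \<open>T\<close> in \<open>TT\<close> and all subsets of \<open>B2\<close>.\<close>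
  define C where "C T U = (if T \<subseteq> heavy \<kappa> A B1 B2
      \<and> real (card A) + \<kappa> / 2 * real q * real (card U) \<le> real (card (A \<union> (T + U)))
    then configs s1 s2 m (A \<union> (T + U)) (refine_left \<kappa> q A B1 B2 T) (refine_right \<kappa> q (A \<union> (T + U)) B2 T)
    else {})" for T U
  define TT where "TT = {T. T \<subseteq> B1 \<and> card T \<le> q}"
  have finTT: "finite TT" unfolding TT_def by (rule finite_subset[of _ "Pow B1"]) (use fin in auto)
  have hB: "heavy \<kappa> A B1 B2 \<subseteq> B1" unfolding heavy_def by auto
  have subL: "refine_left \<kappa> q A B1 B2 T \<subseteq> B1" if "T \<subseteq> B1" for T
    using that unfolding refine_left_def by auto
  have subR: "refine_right \<kappa> q A' B2 T \<subseteq> B2" for A' T unfolding refine_right_def by auto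
  have cardC: "real (card (C T U)) \<le> V * (1 / N ^ card U)" if T: "T \<in> TT" and U: "U \<in> Pow B2" for T U
  proof (cases "C T U = {}")
    case True
    then show ?thesis using V N by simp
  next
    case False
    let ?A' = "A \<union> (T + U)"
    let ?L = "refine_left \<kappa> q A B1 B2 T" and ?R = "refine_right \<kappa> q ?A' B2 T"
    have TB: "T \<subseteq> B1" "card T \<le> q" using T unfolding TT_def by auto
    have cond: "T \<subseteq> heavy \<kappa> A B1 B2"
        "real (card A) + \<kappa> / 2 * real q * real (card U) \<le> real (card ?A')"
      using False unfolding C_def by (auto split: if_splits)
    have C: "C T U = configs s1 s2 m ?A' ?L ?R" using cond unfolding C_def by simp
    have ne: "configs s1 s2 m ?A' ?L ?R \<noteq> {}" using False C by simp
    have "finite T" "finite U" using TB U fin by (auto intro: finite_subset)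
    then have finA': "finite ?A'" using fin by (simp add: finite_set_plus)
    have finLR: "finite ?L" "finite ?R"
      using finite_subset[OF subL[OF TB(1)] fin(2)] finite_subset[OF subR fin(3)] by auto
    note bd = configs_nonempty_bounds[OF ne finLR]
    have neLR: "?L \<noteq> {}" "?R \<noteq> {}" using bd q by auto
    have "real (card (missed_pairs ?A' ?L ?R)) \<le> 3 * \<kappa> * real (card ?L) * real (card ?R)
         \<or> potential \<mu> m ?A' ?L ?R \<le> potential \<mu> m A B1 B2 - \<kappa> / 2"
    proof (cases "card T = q")
      case True
      have "potential \<mu> m ?A' B1 ?R \<le> potential \<mu> m A B1 B2 - \<kappa> / 2"
        by (rule progress_full_fingerprint[OF fin(1) finA' fin(2,3) cond(1) True q(1) \<kappa>(1) _ \<mu> refl neLR(2)]) auto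
      then show ?thesis using True by (simp add: refine_left_def)
    next
      case card: False
      have L: "?L = (B1 - heavy \<kappa> A B1 B2) \<union> T" using card unfolding refine_left_def by simp
      show ?thesis
        by (rule progress_small_fingerprint[OF fin(1) finA' fin(2,3) cond(1) _ \<kappa> _ \<mu>(1) refl neLR(2) L neLR(1)])
          (use bd q in auto)
    qed
    then show ?thesis using refined[OF finA' subL[OF TB(1)] subR ne cond(2)] C by simp
  qed
  have finC: "finite (C T U)" if "T \<in> TT" for T U
  proof -
    have "T \<subseteq> B1" using that unfolding TT_def by auto
    from finite_configs[OF finite_subset[OF subL[OF this] fin(2)] finite_subset[OF subR fin(3)]]
    show ?thesis unfolding C_def by simp
  qed
  have "configs s1 s2 m A B1 B2 \<subseteq> (\<Union>T\<in>TT. \<Union>U\<in>Pow B2. C T U)"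
  proof
    fix X assume X: "X \<in> configs s1 s2 m A B1 B2"
    obtain X1 X2 where X12: "X = (X1, X2)" by fastforce
    from ex_fingerprint[OF X[unfolded X12] fin \<kappa>(1) q(1)] obtain T U where
      TU: "T \<subseteq> heavy \<kappa> A B1 B2" "card T \<le> q" "U \<subseteq> B2"
        "real (card A) + \<kappa> / 2 * real q * real (card U) \<le> real (card (A \<union> (T + U)))"
        "(X1, X2) \<in> configs s1 s2 m (A \<union> (T + U)) (refine_left \<kappa> q A B1 B2 T)
          (refine_right \<kappa> q (A \<union> (T + U)) B2 T)"
      by blast
    then have "X \<in> C T U" "T \<in> TT" unfolding C_def TT_def X12 using hB by auto
    then show "X \<in> (\<Union>T\<in>TT. \<Union>U\<in>Pow B2. C T U)" using TU(3) by blast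
  qed
  then have "card (configs s1 s2 m A B1 B2) \<le> card (\<Union>T\<in>TT. \<Union>U\<in>Pow B2. C T U)"
    by (intro card_mono) (use finTT finC fin in auto)
  also have "\<dots> \<le> (\<Sum>T\<in>TT. card (\<Union>U\<in>Pow B2. C T U))" by (rule card_UN_le[OF finTT])
  also have "\<dots> \<le> (\<Sum>T\<in>TT. \<Sum>U\<in>Pow B2. card (C T U))"
    by (intro sum_mono card_UN_le) (use fin in simp)
  finally have "real (card (configs s1 s2 m A B1 B2)) \<le> real (\<Sum>T\<in>TT. \<Sum>U\<in>Pow B2. card (C T U))"
    by (rule of_nat_mono)
  also have "\<dots> = (\<Sum>T\<in>TT. \<Sum>U\<in>Pow B2. real (card (C T U)))" by simp
  also have "\<dots> \<le> (\<Sum>T\<in>TT. \<Sum>U\<in>Pow B2. V * (1 / N ^ card U))"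
    by (intro sum_mono cardC)
  also have "\<dots> = (\<Sum>T\<in>TT. V * (\<Sum>U\<in>Pow B2. 1 / N ^ card U))"
    by (simp add: sum_distrib_left)
  also have "\<dots> \<le> (\<Sum>T\<in>TT. V * 2)"
    by (intro sum_mono mult_left_mono sum_Pow_inverse_power_le) (use fin N V in auto)
  also have "\<dots> = V * 2 * real (card TT)" by simp
  also have "real (card TT) \<le> 2 * N ^ q"
  proof -
    have "real (card TT) = (\<Sum>T\<in>TT. 1)" by simp
    \<comment> \<open>As \<open>card T \<le> q\<close>, the weight scaled by \<open>N ^ q\<close> is
      at least 1, so the same weighted sum bounds the number of choices.\<close>
    also have "\<dots> \<le> (\<Sum>T\<in>TT. N ^ q * (1 / N ^ card T))"
    proof (rule sum_mono)
      fix T assume "T \<in> TT"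
      then have "N ^ card T \<le> N ^ q" unfolding TT_def using N by (intro power_increasing) auto
      then show "1 \<le> N ^ q * (1 / N ^ card T)" using N by (simp add: field_simps)
    qed
    also have "\<dots> \<le> (\<Sum>T\<in>Pow B1. N ^ q * (1 / N ^ card T))"
      by (rule sum_mono2) (use fin N in \<open>auto simp: TT_def\<close>)
    also have "\<dots> = N ^ q * (\<Sum>T\<in>Pow B1. 1 / N ^ card T)" by (simp add: sum_distrib_left)
    also have "\<dots> \<le> N ^ q * 2"
      by (intro mult_left_mono sum_Pow_inverse_power_le) (use fin N in auto)
    finally show ?thesis by simp
  qed
  also have "V * 2 * (2 * N ^ q) = V * (4 * N ^ q)" by simp
  also have "\<dots> \<le> V * (N * N ^ q)" using N V by (intro mult_left_mono mult_right_mono) auto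
  finally show ?thesis using V by (simp add: mult_left_mono)
qed

text \<open>Each round that makes progress costs a factor \<open>N ^ (q + 1)\<close> and uses up
  \<open>\<kappa> / 2\<close> of the potential. The elements of \<open>U\<close> are charged to the
  growth of \<open>A\<close> instead: each adds \<open>\<kappa> / 2 * q\<close> on average, and
  \<open>card A\<close> never exceeds \<open>m\<close>. This is the second term of the
  exponent.\<close>

theorem container_count:
  fixes F1 F2 :: "'a::ab_group_add set" and N Q \<kappa> \<mu> :: real
  assumes finF: "finite F1" "finite F2"
    and N: "4 \<le> N" "2 * real (card F1) \<le> N" "2 * real (card F2) \<le> N" and Q: "0 \<le> Q"
    and \<kappa>: "0 < \<kappa>" "\<kappa> \<le> 1" and q: "0 < q" "q \<le> s1" "q \<le> s2" and \<mu>: "0 < \<mu>"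
    and terminal: "\<And>A B1 B2. finite A \<Longrightarrow> B1 \<subseteq> F1 \<Longrightarrow> B2 \<subseteq> F2 \<Longrightarrow> configs s1 s2 m A B1 B2 \<noteq> {}
      \<Longrightarrow> real (card B1) \<le> \<mu> \<and> real (card B2) \<le> \<mu>
        \<or> real (card (missed_pairs A B1 B2)) \<le> 3 * \<kappa> * real (card B1) * real (card B2)
      \<Longrightarrow> real (card (configs s1 s2 m A B1 B2)) \<le> Q"
    and "finite A" "B1 \<subseteq> F1" "B2 \<subseteq> F2" "configs s1 s2 m A B1 B2 \<noteq> {}"
    and "potential \<mu> m A B1 B2 \<le> \<kappa> / 2 * real k"
  shows "real (card (configs s1 s2 m A B1 B2))
    \<le> Q * N powr ((real q + 1) * (real k + 1) + 2 * (real m - real (card A)) / (\<kappa> * real q))"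
  using assms(14-)
proof (induction k arbitrary: A B1 B2 rule: less_induct)
  case (less k)
  note prems = less.prems
  define E where "E = 2 * (real m - real (card A)) / (\<kappa> * real q)"
  have finB: "finite B1" "finite B2" using prems finF finite_subset by auto
  note bd = configs_nonempty_bounds[OF prems(4) finB]
  have E0: "E \<ge> 0" unfolding E_def using bd \<kappa> by simp
  show ?case
  proof (cases "real (card B1) \<le> \<mu> \<and> real (card B2) \<le> \<mu>
        \<or> real (card (missed_pairs A B1 B2)) \<le> 3 * \<kappa> * real (card B1) * real (card B2)")
    case True
    have "1 \<le> N powr ((real q + 1) * (real k + 1) + E)"
      using N E0 by (intro ge_one_powr_ge_zero) auto
    then have "Q * 1 \<le> Q * N powr ((real q + 1) * (real k + 1) + E)"
      by (rule mult_left_mono[OF _ Q])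
    then show ?thesis using terminal[OF prems(1-4) True] unfolding E_def by simp
  next
    case False
    \<comment> \<open>The target without one factor \<open>N ^ (q + 1)\<close>, which
      \<open>container_round\<close> spends.\<close>
    define V where "V = Q * N powr ((real q + 1) * real k + E)"
    have V: "0 \<le> V" unfolding V_def using Q by simp
    have refined: "real (card (configs s1 s2 m A' B1' B2')) \<le> V / N ^ u"
      if "finite A'" "B1' \<subseteq> B1" "B2' \<subseteq> B2" "configs s1 s2 m A' B1' B2' \<noteq> {}"
        and growth: "real (card A) + \<kappa> / 2 * real q * real u \<le> real (card A')"
        and prog: "real (card (missed_pairs A' B1' B2')) \<le> 3 * \<kappa> * real (card B1') * real (card B2')
         \<or> potential \<mu> m A' B1' B2' \<le> potential \<mu> m A B1 B2 - \<kappa> / 2" for A' B1' B2' u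
    proof -
      define E' where "E' = 2 * (real m - real (card A')) / (\<kappa> * real q)"
      have sub: "B1' \<subseteq> F1" "B2' \<subseteq> F2" using that prems by auto
      have finB': "finite B1'" "finite B2'" using sub finF finite_subset by auto
      note bd' = configs_nonempty_bounds[OF that(4) finB']
      have E'0: "E' \<ge> 0" unfolding E'_def using bd' \<kappa> by simp
      \<comment> \<open>The growth lowers the second term of the exponent by at least
        \<open>u\<close>, which pays for the division by \<open>N ^ u\<close>.\<close>
      have "real u \<le> 2 * (real (card A') - real (card A)) / (\<kappa> * real q)"
        using growth \<kappa> q by (simp add: field_simps)
      also have "\<dots> = E - E'" unfolding E_def E'_def by (simp add: diff_divide_distrib algebra_simps)
      finally have u: "real u \<le> E - E'" .
      have key: "Q * N powr x \<le> V / N ^ u" if "x + real u \<le> (real q + 1) * real k + E" for x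
      proof -
        have "N powr x * N ^ u = N powr (x + real u)" using N by (simp add: powr_add powr_realpow)
        also have "\<dots> \<le> N powr ((real q + 1) * real k + E)" using N that by (intro powr_mono) auto
        finally have "Q * (N powr x * N ^ u) \<le> V" unfolding V_def by (rule mult_left_mono[OF _ Q])
        then show ?thesis using N by (simp add: pos_le_divide_eq mult.assoc)
      qed
      show ?thesis
      proof (cases "real (card (missed_pairs A' B1' B2')) \<le> 3 * \<kappa> * real (card B1') * real (card B2')")
        case True
        have "real (card (configs s1 s2 m A' B1' B2')) \<le> Q"
          using terminal[OF that(1) sub that(4)] True by blast
        also have "\<dots> = Q * N powr 0" using N by simp
        also have "\<dots> \<le> V / N ^ u" by (rule key) (use u E'0 in \<open>simp add: add_increasing\<close>)
        finally show ?thesis .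
      next
        case False
        then have pot: "potential \<mu> m A' B1' B2' \<le> \<kappa> / 2 * (real k - 1)"
          using prog prems(5) by (simp add: algebra_simps)
        have pot0: "potential \<mu> m A' B1' B2' \<ge> 0"
          unfolding potential_def using bd' q \<mu> by (intro add_nonneg_nonneg) auto
        \<comment> \<open>The potential is nonnegative, so no further decrease is possible at
          \<open>k = 0\<close>.\<close>
        have "k > 0"
        proof (rule ccontr)
          assume "\<not> k > 0"
          then show False using pot pot0 \<kappa> by simp
        qed
        have "real (card (configs s1 s2 m A' B1' B2'))
            \<le> Q * N powr ((real q + 1) * (real (k - 1) + 1) + 2 * (real m - real (card A')) / (\<kappa> * real q))"
          by (rule less.IH) (use \<open>k > 0\<close> that sub pot in \<open>auto simp: of_nat_diff\<close>)
        also have "\<dots> \<le> V / N ^ u"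
          by (rule key) (use \<open>k > 0\<close> u in \<open>simp add: of_nat_diff E'_def\<close>)
        finally show ?thesis .
      qed
    qed
    have NB: "2 * real (card B1) \<le> N" "2 * real (card B2) \<le> N"
      using N card_mono[OF finF(1) prems(2)] card_mono[OF finF(2) prems(3)] by linarith+
    have "real (card (configs s1 s2 m A B1 B2)) \<le> V * N ^ (q + 1)"
    proof (cases "\<mu> < real (card B2)")
      case True
      show ?thesis
        by (rule container_round[OF prems(1) finB N(1) NB V \<kappa> q(1,2) _ \<mu> True refined]) (use q in auto)
    next
      case small: False
      have True: "\<mu> < real (card B1)" using False small by auto
      \<comment> \<open>Only the first container is still large, so the round exchanges the roles of
        the two sets.\<close>
      have "real (card (configs s2 s1 m A B2 B1)) \<le> V * N ^ (q + 1)"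
      proof (rule container_round[OF prems(1) finB(2,1) N(1) NB(2,1) V \<kappa> q(1,3) _ \<mu> True])
        fix A' B1' B2' :: "'a set" and u :: nat
        assume *: "finite A'" "B2' \<subseteq> B2" "B1' \<subseteq> B1" "configs s2 s1 m A' B2' B1' \<noteq> {}"
          "real (card A) + \<kappa> / 2 * real q * real u \<le> real (card A')"
          "real (card (missed_pairs A' B2' B1')) \<le> 3 * \<kappa> * real (card B2') * real (card B1')
           \<or> potential \<mu> m A' B2' B1' \<le> potential \<mu> m A B2 B1 - \<kappa> / 2"
        have "configs s1 s2 m A' B1' B2' \<noteq> {}" using *(4) unfolding configs_swap[of s2 s1] by simp
        moreover have "real (card (missed_pairs A' B1' B2')) \<le> 3 * \<kappa> * real (card B1') * real (card B2')
           \<or> potential \<mu> m A' B1' B2' \<le> potential \<mu> m A B1 B2 - \<kappa> / 2"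
          using *(6) card_missed_pairs_swap[of A' B1' B2'] unfolding potential_def by (simp add: algebra_simps)
        ultimately show "real (card (configs s2 s1 m A' B2' B1')) \<le> V / N ^ u"
          unfolding card_configs_swap[of s2 s1 m A' B2' B1'] by (intro refined *(1,2,3,5))
      qed (use q in auto)
      then show ?thesis by (simp add: card_configs_swap[of s2 s1])
    qed
    also have "\<dots> = Q * N powr ((real q + 1) * (real k + 1) + E)"
    proof -
      have "N ^ (q + 1) = N powr (real q + 1)"
        using N powr_realpow[of N "q + 1"] by (simp add: add.commute)
      then have "V * N ^ (q + 1) = Q * (N powr ((real q + 1) * real k + E) * N powr (real q + 1))"
        unfolding V_def by simp
      also have "\<dots> = Q * N powr ((real q + 1) * (real k + 1) + E)"
        unfolding powr_add[symmetric] by (simp add: algebra_simps)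
      finally show ?thesis .
    qed
    finally show ?thesis unfolding E_def .
  qed
qed

section \<open>Binomial coefficients\<close>

text \<open>The factors of the generalized coefficient of \<open>s * c\<close> over \<open>s\<close>
  depend only on \<open>i / s\<close>. For \<open>1 \<le> c\<close>, coefficients with the same
  ratio \<open>c\<close> are thus products of one nondecreasing function over different grids in
  \<open>[0, 1)\<close>.\<close>

definition tilt :: "real \<Rightarrow> real \<Rightarrow> real" where
  "tilt c y = (c - y) / (1 - y)"

lemma tilt_ge_1: "1 \<le> c \<Longrightarrow> y < 1 \<Longrightarrow> 1 \<le> tilt c y"
  unfolding tilt_def by (simp add: field_simps)

lemma tilt_mono: "1 \<le> c \<Longrightarrow> x \<le> y \<Longrightarrow> y < 1 \<Longrightarrow> tilt c x \<le> tilt c y"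
proof -
  assume c: "1 \<le> c" and xy: "x \<le> y" "y < 1"
  have "tilt c z = 1 + (c - 1) / (1 - z)" if "z < 1" for z
    using that unfolding tilt_def by (simp add: field_simps)
  moreover have "(c - 1) / (1 - x) \<le> (c - 1) / (1 - y)"
    using c xy by (intro divide_left_mono) auto
  ultimately show ?thesis using xy by simp
qed

lemma gbinomial_eq_prod_tilt:
  fixes c :: real
  assumes "0 < s"
  shows "(real s * c) gchoose s = (\<Prod>i<s. tilt c (real i / real s))"
proof -
  have "(real s * c) gchoose s = (\<Prod>i = 0..<s. (real s * c - real i) / real (s - i))"
    by (rule gbinomial_altdef_of_nat)
  also have "\<dots> = (\<Prod>i = 0..<s. tilt c (real i / real s))"
  proof (rule prod.cong)
    fix i assume i: "i \<in> {0..<s}"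
    then have "real s - real i > 0" by simp
    then show "(real s * c - real i) / real (s - i) = tilt c (real i / real s)"
      using i assms unfolding tilt_def by (simp add: of_nat_diff field_simps)
  qed simp
  finally show ?thesis by (simp add: atLeast0LessThan)
qed

lemma one_le_gbinomial:
  fixes c :: real
  assumes "1 \<le> c"
  shows "1 \<le> (real s * c) gchoose s"
proof (cases "s = 0")
  case False
  then show ?thesis
    using gbinomial_eq_prod_tilt[of s c] by (auto intro!: prod_ge_1 tilt_ge_1[OF assms])
qed simp

text \<open>With \<open>a = \<lfloor>k s1 / S\<rfloor>\<close>, the grid point \<open>k / S\<close> is matched either to \<open>(a + 1) / s1\<close> or to
  \<open>(k - a) / s2\<close>, neither of which lies below it.\<close>

lemma prod_tilt_interleave:
  fixes s1 s2 :: nat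
  assumes s: "0 < s1" "0 < s2" and c: "1 \<le> c"
  shows "k < s1 + s2 \<Longrightarrow> (\<Prod>l<k. tilt c (real l / real (s1 + s2)))
    \<le> (\<Prod>i<k * s1 div (s1 + s2). tilt c (real (i + 1) / real s1))
      * (\<Prod>j<k - k * s1 div (s1 + s2). tilt c (real j / real s2))"
proof (induction k)
  case 0
  then show ?case by simp
next
  case (Suc k)
  define S where "S = s1 + s2"
  define a where "a = k * s1 div S"
  define a' where "a' = Suc k * s1 div S"
  have S: "0 < S" "s1 < S" "s2 < S" unfolding S_def using s by auto
  have k: "Suc k < S" using Suc.prems unfolding S_def .
  have lo: "a * S \<le> k * s1" "a' * S \<le> Suc k * s1" unfolding a_def a'_def by simp_all
  have hi: "k * s1 < (a + 1) * S" "Suc k * s1 < (a' + 1) * S"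
    unfolding a_def a'_def using dividend_less_div_times[OF S(1)] by (simp_all add: algebra_simps)
  have aa': "a \<le> a'" unfolding a_def a'_def by (intro div_le_mono) simp
  \<comment> \<open>As \<open>s1 < S\<close>, one step raises the quotient by at most 1, so exactly
    one of the two grids advances.\<close>
  have "a' * S < (a + 2) * S"
  proof -
    have "a' * S \<le> k * s1 + s1" using lo by simp
    also have "\<dots> < (a + 1) * S + S" using hi S by linarith
    finally show ?thesis by (simp add: algebra_simps)
  qed
  then have "a' < a + 2" using S by (metis mult_less_cancel2)
  then consider "a' = a + 1" | "a' = a" using aa' by linarith
  \<comment> \<open>Keeps the point matched in the first grid below 1, where \<open>tilt\<close> is
    monotone.\<close>
  moreover have as1: "a' < s1"
  proof -
    have "a' * S < S * s1" using lo k s by (metis le_less_trans mult_less_mono1)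
    then show ?thesis by (simp add: mult.commute)
  qed
  have ak: "a \<le> k"
  proof -
    have "a * S \<le> k * S" using lo S by (meson le_trans less_imp_le mult_le_mono2)
    then show ?thesis using S by simp
  qed
  have IH: "(\<Prod>l<k. tilt c (real l / real S))
    \<le> (\<Prod>i<a. tilt c (real (i + 1) / real s1)) * (\<Prod>j<k - a. tilt c (real j / real s2))"
    using Suc.IH k unfolding S_def a_def by simp
  have t0: "0 \<le> tilt c (real k / real S)"
    using tilt_ge_1[OF c, of "real k / real S"] k by simp
  have ge0: "0 \<le> (\<Prod>i<a. tilt c (real (i + 1) / real s1)) * (\<Prod>j<k - a. tilt c (real j / real s2))"
  proof -
    have "0 \<le> (\<Prod>l<k. tilt c (real l / real S))"
    proof (rule prod_nonneg)
      fix l assume "l \<in> {..<k}"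
      then have "real l / real S < 1" using k by simp
      then show "0 \<le> tilt c (real l / real S)" using tilt_ge_1[OF c] by fastforce
    qed
    then show ?thesis using IH by linarith
  qed
  have main: "(\<Prod>l<Suc k. tilt c (real l / real S))
    \<le> (\<Prod>i<a'. tilt c (real (i + 1) / real s1)) * (\<Prod>j<Suc k - a'. tilt c (real j / real s2))"
    using calculation
  proof cases
    case 1
    have "real k * real s1 \<le> (real a + 1) * real S"
      using hi(1) by (metis less_imp_le of_nat_1 of_nat_add of_nat_le_iff of_nat_mult)
    then have "real k / real S \<le> (real a + 1) / real s1"
      using s S by (simp add: field_simps)
    then have "tilt c (real k / real S) \<le> tilt c (real (a + 1) / real s1)"
      by (intro tilt_mono[OF c]) (use as1 1 in \<open>auto simp: add.commute\<close>)
    then have "(\<Prod>l<k. tilt c (real l / real S)) * tilt c (real k / real S)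
        \<le> ((\<Prod>i<a. tilt c (real (i + 1) / real s1)) * (\<Prod>j<k - a. tilt c (real j / real s2)))
          * tilt c (real (a + 1) / real s1)"
      by (rule mult_mono[OF IH _ ge0 t0])
    moreover have "Suc k - a' = k - a" using 1 ak by simp
    ultimately show ?thesis using 1 by (simp add: mult_ac)
  next
    case 2
    have "real a * real S \<le> real k * real s1"
      using lo(1) by (metis of_nat_le_iff of_nat_mult)
    then have "real k / real S \<le> (real k - real a) / real s2"
      using s S unfolding S_def by (simp add: field_simps)
    then have le: "real k / real S \<le> real (k - a) / real s2" using ak by (simp add: of_nat_diff)
    \<comment> \<open>Likewise keeps the point matched in the second grid below 1.\<close>
    have "Suc k - a \<le> s2"
    proof -
      have "Suc k * S < Suc k * s2 + (a + 1) * S"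
        using hi(2) 2 unfolding S_def by (simp add: algebra_simps)
      also have "Suc k * s2 < S * s2" using k s(2) by (rule mult_strict_right_mono)
      finally have "Suc k * S < (s2 + a + 1) * S" by (simp add: algebra_simps)
      then have "Suc k < s2 + a + 1" using S by (metis mult_less_cancel2)
      then show ?thesis by simp
    qed
    then have "k - a < s2" using ak by simp
    then have "tilt c (real k / real S) \<le> tilt c (real (k - a) / real s2)"
      by (intro tilt_mono[OF c le]) auto
    then have "(\<Prod>l<k. tilt c (real l / real S)) * tilt c (real k / real S)
        \<le> ((\<Prod>i<a. tilt c (real (i + 1) / real s1)) * (\<Prod>j<k - a. tilt c (real j / real s2)))
          * tilt c (real (k - a) / real s2)"
      by (rule mult_mono[OF IH _ ge0 t0])
    moreover have "Suc k - a' = Suc (k - a)" using 2 ak by simp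
    ultimately show ?thesis using 2 by (simp add: mult_ac)
  qed
  then show ?case unfolding S_def a'_def .
qed

text \<open>With \<open>S = s1 + s2\<close>, all three coefficients have the ratio
  \<open>M / S\<close>. Interleaving bounds all factors on the left but the last, which is
  \<open>M - (S - 1)\<close> and accounts for the factor \<open>M\<close>; the point 0 of the first
  grid stays unmatched, and its factor is at least 1.\<close>

lemma choose_le_gchoose_mult_gchoose:
  fixes s1 s2 M :: nat
  assumes s: "0 < s1" "0 < s2" and M: "s1 + s2 \<le> M"
  shows "real (M choose (s1 + s2)) \<le> real M
    * ((real s1 * real M / (real s1 + real s2)) gchoose s1)
    * ((real s2 * real M / (real s1 + real s2)) gchoose s2)"
proof -
  define S where "S = s1 + s2"
  define c where "c = real M / real S"
  have S: "0 < S" unfolding S_def using s by simp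
  have c: "1 \<le> c" unfolding c_def using M s unfolding S_def by (subst pos_le_divide_eq) auto
  define G1 where "G1 = (\<Prod>i<s1. tilt c (real i / real s1))"
  define G2 where "G2 = (\<Prod>j<s2. tilt c (real j / real s2))"
  have G1: "G1 \<ge> 1" unfolding G1_def by (rule prod_ge_1) (use s in \<open>auto intro!: tilt_ge_1[OF c]\<close>)
  have G2: "G2 \<ge> 1" unfolding G2_def by (rule prod_ge_1) (use s in \<open>auto intro!: tilt_ge_1[OF c]\<close>)
  have gS: "real (M choose S) = (\<Prod>l<S. tilt c (real l / real S))"
    using gbinomial_eq_prod_tilt[OF S, of c] S by (simp add: c_def binomial_gbinomial)
  obtain S' where S': "S = Suc S'" using S by (cases S) auto
  obtain t1 where t1: "s1 = Suc t1" using s by (cases s1) auto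
  have div: "S' * s1 div S = t1"
  proof (rule div_nat_eqI)
    show "S * t1 \<le> S' * s1" "S' * s1 < S * Suc t1"
      using S' t1 s unfolding S_def by (auto simp: algebra_simps)
  qed
  have diff: "S' - t1 = s2" using S' t1 unfolding S_def by simp
  have "(\<Prod>l<S'. tilt c (real l / real S)) \<le> (\<Prod>i<t1. tilt c (real (i + 1) / real s1)) * G2"
    using prod_tilt_interleave[OF s c, of S'] S' div diff unfolding S_def[symmetric] G2_def by simp
  also have "\<dots> \<le> G1 * G2"
  proof (rule mult_right_mono)
    have "G1 = tilt c 0 * (\<Prod>i<t1. tilt c (real (i + 1) / real s1))"
      unfolding G1_def t1 by (subst prod.lessThan_Suc_shift) (simp add: add.commute)
    moreover have "1 * (\<Prod>i<t1. tilt c (real (i + 1) / real s1))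
        \<le> tilt c 0 * (\<Prod>i<t1. tilt c (real (i + 1) / real s1))"
    proof (rule mult_right_mono)
      show "1 \<le> tilt c 0" by (rule tilt_ge_1[OF c]) simp
      have "1 \<le> (\<Prod>i<t1. tilt c (real (i + 1) / real s1))"
        by (rule prod_ge_1) (use t1 in \<open>auto intro!: tilt_ge_1[OF c]\<close>)
      then show "0 \<le> (\<Prod>i<t1. tilt c (real (i + 1) / real s1))" by linarith
    qed
    ultimately show "(\<Prod>i<t1. tilt c (real (i + 1) / real s1)) \<le> G1" by simp
  qed (use G2 in simp)
  finally have le: "(\<Prod>l<S'. tilt c (real l / real S)) \<le> G1 * G2" .
  have last: "tilt c (real S' / real S) = real M - real S'"
  proof -
    have "1 - real S' / real S = 1 / real S" unfolding S' by (simp add: field_simps)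
    then show ?thesis using S unfolding tilt_def c_def by (simp flip: diff_divide_distrib)
  qed
  have "real (M choose S) = (\<Prod>l<S'. tilt c (real l / real S)) * (real M - real S')"
    unfolding gS by (subst S') (simp add: last)
  also have "\<dots> \<le> G1 * G2 * real M"
    by (rule mult_mono[OF le]) (use G1 G2 M S' S_def in auto)
  finally have "real (M choose S) \<le> real M * G1 * G2" by (simp add: mult_ac)
  moreover have "G1 = (real s1 * real M / (real s1 + real s2)) gchoose s1"
    using gbinomial_eq_prod_tilt[OF s(1), of c] unfolding G1_def c_def S_def by simp
  moreover have "G2 = (real s2 * real M / (real s1 + real s2)) gchoose s2"
    using gbinomial_eq_prod_tilt[OF s(2), of c] unfolding G2_def c_def S_def by simp
  ultimately show ?thesis unfolding S_def by simp
qed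

section \<open>Effect of enlarging the upper argument\<close>

text \<open>Factor by factor the ratio is \<open>1 + (M' - M) / (M - i)\<close>, at most the
  exponential of the second summand.\<close>

lemma choose_le_exp_mult_choose:
  fixes M M' S :: nat
  assumes "S \<le> M" "M \<le> M'"
  shows "real (M' choose S)
    \<le> exp ((real M' - real M) * (\<Sum>i<S. 1 / (real M - real i))) * real (M choose S)"
proof -
  have "real (M' choose S) = (\<Prod>i<S. real (M' - i) / real (S - i))"
    using assms by (simp add: binomial_altdef_of_nat atLeast0LessThan)
  also have "\<dots> \<le> (\<Prod>i<S. exp ((real M' - real M) * (1 / (real M - real i))) * (real (M - i) / real (S - i)))"
  proof (rule prod_mono, intro conjI)
    fix i assume i: "i \<in> {..<S}"
    define d where "d = real M - real i"
    have d: "d > 0" unfolding d_def using i assms by simp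
    have "real (M' - i) = (1 + (real M' - real M) * (1 / d)) * real (M - i)"
      using i assms d unfolding d_def by (simp add: of_nat_diff field_simps)
    also have "\<dots> \<le> exp ((real M' - real M) * (1 / d)) * real (M - i)"
      by (rule mult_right_mono) auto
    finally have "real (M' - i) / real (S - i)
        \<le> exp ((real M' - real M) * (1 / d)) * real (M - i) / real (S - i)"
      by (rule divide_right_mono) simp
    then show "real (M' - i) / real (S - i)
        \<le> exp ((real M' - real M) * (1 / (real M - real i))) * (real (M - i) / real (S - i))"
      unfolding d_def by simp
  qed simp
  also have "\<dots> = exp ((real M' - real M) * (\<Sum>i<S. 1 / (real M - real i))) * real (M choose S)"
  proof -
    have "real (M choose S) = (\<Prod>i<S. real (M - i) / real (S - i))"
      using assms by (simp add: binomial_altdef_of_nat atLeast0LessThan)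
    then show ?thesis by (simp only: prod.distrib exp_sum[OF finite_lessThan, symmetric] sum_distrib_left)
  qed
  finally show ?thesis .
qed

lemma harmonic_sum_le:
  assumes "0 < n"
  shows "(\<Sum>i<n. 1 / (real n - real i)) \<le> 1 + ln (real n)"
proof -
  have "(\<Sum>i<n. 1 / (real n - real i)) = (\<Sum>i<n. 1 / (real (n - Suc i) + 1))"
    by (rule sum.cong) (auto simp: of_nat_diff)
  also have "\<dots> = (\<Sum>j<n. 1 / (real j + 1))"
    by (rule sum.nat_diff_reindex)
  also have "\<dots> \<le> 1 + ln (real n)"
    using assms
  proof (induction n rule: nat_induct_non_zero)
    case 1
    then show ?case by simp
  next
    case (Suc n)
    have "ln (real n / (real n + 1)) \<le> real n / (real n + 1) - 1"
      using Suc.hyps by (intro ln_le_minus_one) auto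
    also have "\<dots> = - (1 / (real n + 1))" by (simp add: field_simps)
    finally have "1 / (real n + 1) \<le> ln (real n + 1) - ln (real n)"
      using Suc.hyps by (simp add: ln_div)
    then show ?case using Suc.IH by (simp add: add.commute)
  qed
  finally show ?thesis .
qed

text \<open>Both terms of \<open>lambda_param\<close> originate here: bounding every summand by
  \<open>1 / (m - S)\<close> gives the quotient, comparison with the harmonic sum gives the
  logarithm.\<close>

lemma sum_inverse_le_lambda:
  assumes s: "s1 + s2 = S" and S: "0 < S" "1 \<le> ln (real S)" and m: "S \<le> m" "m \<le> M"
  shows "real m * (\<Sum>i<S. 1 / (real M - real i)) \<le> 4 * real S * lambda_param s1 s2 m"
proof -
  define \<Sigma> where "\<Sigma> = (\<Sum>i<S. 1 / (real M - real i))"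
  have frac: "real m * \<Sigma> \<le> real S * (real m / (real m - real S))" if "S < m"
  proof -
    have "\<Sigma> \<le> (\<Sum>i<S. 1 / (real m - real S))"
      unfolding \<Sigma>_def by (intro sum_mono divide_left_mono) (use that m in auto)
    then have "real m * \<Sigma> \<le> real m * (real S / (real m - real S))"
      by (intro mult_left_mono) auto
    then show ?thesis by (simp add: mult_ac)
  qed
  have \<lambda>: "lambda_param s1 s2 m = (if m = S then ln (real S) else min (real m / (real m - real S)) (ln (real S)))"
    unfolding lambda_param_def s[symmetric] by (simp add: diff_diff_eq)
  have one: "1 \<le> real m / (real m - real S)" if "S < m" using that by simp
  show ?thesis
  proof (cases "2 * S \<le> m")
    case True
    \<comment> \<open>For such large \<open>m\<close> the quotient is at most 2, and
      \<open>lambda_param\<close> being at least 1 is enough.\<close>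
    then have Sm: "S < m" using S by simp
    have "real m / (real m - real S) \<le> 2" using True Sm by (simp add: field_simps)
    then have "real S * (real m / (real m - real S)) \<le> real S * 2" by (rule mult_left_mono) simp
    then have "real m * \<Sigma> \<le> real S * 2" using frac[OF Sm] by linarith
    moreover have "1 \<le> lambda_param s1 s2 m" unfolding \<lambda> using S one Sm by simp
    then have "real S * 1 \<le> real S * lambda_param s1 s2 m" by (rule mult_left_mono) simp
    ultimately show ?thesis unfolding \<Sigma>_def by linarith
  next
    case False
    have "\<Sigma> \<le> (\<Sum>i<S. 1 / (real S - real i))"
      unfolding \<Sigma>_def by (intro sum_mono divide_left_mono) (use m in auto)
    also have "\<dots> \<le> 2 * ln (real S)" using harmonic_sum_le[OF S(1)] S by linarith
    \<comment> \<open>As \<open>m < 2 * S\<close>, the outer factor is replaced by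
      \<open>2 * S\<close>; together with \<open>1 + ln S \<le> 2 * ln S\<close> this gives the
      constant 4.\<close>
    finally have "real m * \<Sigma> \<le> (2 * real S) * (2 * ln (real S))"
      using False S by (intro mult_mono) (auto simp: \<Sigma>_def intro!: sum_nonneg divide_nonneg_nonneg, use m in auto)
    then have log: "real m * \<Sigma> \<le> 4 * real S * ln (real S)" by simp
    show ?thesis
    proof (cases "m = S \<or> ln (real S) \<le> real m / (real m - real S)")
      case True
      then have "lambda_param s1 s2 m = ln (real S)" unfolding \<lambda> by auto
      then show ?thesis using log unfolding \<Sigma>_def by simp
    next
      case fr: False
      then have Sm: "S < m" using m by simp
      have "lambda_param s1 s2 m = real m / (real m - real S)" unfolding \<lambda> using fr by auto
      moreover have "0 \<le> real S * (real m / (real m - real S))" using Sm by simp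
      ultimately show ?thesis using frac[OF Sm] unfolding \<Sigma>_def by simp
    qed
  qed
qed

section \<open>Choices inside containers of bounded total size\<close>

lemma choose_mult_choose_le: "(a choose s) * (b choose t) \<le> (a + b) choose (s + t)"
proof -
  have "(a choose s) * (b choose (s + t - s)) \<le> (\<Sum>k\<le>s + t. (a choose k) * (b choose (s + t - k)))"
    by (rule member_le_sum) auto
  then show ?thesis by (simp add: vandermonde)
qed

lemma card_configs_le_choose:
  assumes "finite B1" "finite B2" "card B1 + card B2 \<le> M"
  shows "card (configs s1 s2 m A B1 B2) \<le> M choose (s1 + s2)"
proof -
  have "card (configs s1 s2 m A B1 B2)
      \<le> card ({X. X \<subseteq> B1 \<and> card X = s1} \<times> {X. X \<subseteq> B2 \<and> card X = s2})"
    by (rule card_mono) (use assms in \<open>auto simp: configs_def\<close>)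
  also have "\<dots> = (card B1 choose s1) * (card B2 choose s2)"
    using assms by (simp add: card_cartesian_product n_subsets)
  also have "\<dots> \<le> (card B1 + card B2) choose (s1 + s2)" by (rule choose_mult_choose_le)
  also have "\<dots> \<le> M choose (s1 + s2)" using assms(3) by (rule binomial_right_mono)
  finally show ?thesis .
qed

text \<open>The bound \<open>T\<close> and the trivial subgroup make \<open>Max\<close> range over a
  finite nonempty set, so it is an upper bound and is attained.\<close>

lemma subgroup_beta_bounds:
  fixes T :: real
  assumes "1 \<le> T"
  shows "\<And>H :: 'a::ab_group_add set. add_subgroup H \<Longrightarrow> finite H \<Longrightarrow> real (card H) \<le> T
      \<Longrightarrow> card H \<le> subgroup_beta TYPE('a) T"
    and "real (subgroup_beta TYPE('a) T) \<le> T"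
proof -
  let ?C = "{card H | H :: 'a set. add_subgroup H \<and> finite H \<and> real (card H) \<le> T}"
  have "?C \<subseteq> {..nat \<lfloor>T\<rfloor>}" by (auto simp: le_nat_floor)
  then have fin: "finite ?C" by (rule finite_subset) simp
  show "card H \<le> subgroup_beta TYPE('a) T"
    if "add_subgroup H" "finite H" "real (card H) \<le> T" for H :: "'a set"
    unfolding subgroup_beta_def by (rule Max_ge[OF fin]) (use that in blast)
  have "add_subgroup {0 :: 'a}" unfolding add_subgroup_def by simp
  then have "card {0 :: 'a} \<in> ?C" using assms by fastforce
  then have "Max ?C \<in> ?C" using fin by (intro Max_in) auto
  then show "real (subgroup_beta TYPE('a) T) \<le> T" unfolding subgroup_beta_def by auto
qed

section \<open>The counting theorem\<close>

text \<open>The equation for \<open>\<epsilon> ^ 3\<close> makes the cost of the fingerprints, of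
  order \<open>sqrt m * L * sqrt L / \<epsilon>\<^sup>2\<close>, comparable with
  \<open>\<epsilon> * lam * S\<close>, which is also the order of the cost of enlarging
  \<open>M\<close> by \<open>16 * (\<epsilon> * m)\<close>. The coefficients 46, 64 and 4 that arise
  add up to less than 1024.\<close>

lemma counting_bound:
  fixes F1 F2 :: "'a::ab_group_add set" and s1 s2 n m \<beta> :: nat and \<epsilon> lam L S :: real
  assumes s: "2 \<le> s1" "s1 \<le> s2" and S: "S = real s1 + real s2" and m: "s1 + s2 \<le> m"
    and L: "L = ln (real n)" "2 \<le> L" "L \<le> real m" "real m * L \<le> (real s1)\<^sup>2" and n: "4 \<le> n"
    and lnS: "1 \<le> ln S" and lam: "lam = lambda_param s1 s2 m"
    and \<epsilon>: "0 < \<epsilon>" "\<epsilon> \<le> 1 / 256" "1 \<le> \<epsilon> * real m" "\<epsilon> ^ 3 * lam * S = sqrt (real m) * L * sqrt L"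
    and \<beta>: "\<beta> = subgroup_beta TYPE('a) (real m + 256 * (\<epsilon> * real m))"
    and F: "finite F1" "finite F2" "card F1 = n" "card F2 = n"
  shows "real (card (configs s1 s2 m {} F1 F2))
    \<le> exp (1024 * (\<epsilon> * lam * S))
      * ((real s1 * (real m + real \<beta>) / S) gchoose s1)
      * ((real s2 * (real m + real \<beta>) / S) gchoose s2)"
proof -
  define r where "r = sqrt (real m)"
  define w where "w = sqrt L"
  define \<kappa> where "\<kappa> = \<epsilon>\<^sup>2"
  \<comment> \<open>Up to constants, with \<open>L / \<kappa>\<close> rounds the sets
    \<open>T\<close> cost \<open>q * L\<^sup>2 / \<kappa>\<close> in the exponent and the sets
    \<open>U\<close> cost \<open>m * L / (\<kappa> * q)\<close>; \<open>q\<close> near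
    \<open>sqrt (m / L)\<close> balances them.\<close>
  define q where "q = nat \<lceil>r / w\<rceil>"
  define T where "T = real m + 256 * (\<epsilon> * real m)"
  define M where "M = m + \<beta>"
  \<comment> \<open>The 16 is the 8 of \<open>card_add_le_if_few_missed\<close> with
    \<open>\<eta> = 2 * \<epsilon>\<close>, chosen since
    \<open>(2 * \<epsilon>)\<^sup>2 = 4 * \<kappa>\<close> exceeds the terminal density
    \<open>3 * \<kappa>\<close>.\<close>
  define M' where "M' = nat \<lfloor>real m + real \<beta> + 16 * (\<epsilon> * real m)\<rfloor>"
  define Q where "Q = real (M' choose (s1 + s2))"
  define N where "N = 2 * real n + 4"
  \<comment> \<open>The initial potential with \<open>\<mu> = m / 2\<close> is
    \<open>2 * L + 2\<close>, and each round of progress lowers it by at least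
    \<open>\<kappa> / 2\<close>.\<close>
  define k where "k = nat \<lceil>2 / \<kappa> * (2 * L + 2)\<rceil>"
  define K where "K = \<epsilon> * lam * S"
  have m4: "4 \<le> m" using s m by linarith
  have r2: "r * r = real m" unfolding r_def by simp
  have w2: "w * w = L" unfolding w_def using L by simp
  have r: "1 \<le> r" unfolding r_def using m4 by simp
  have w: "1 \<le> w" unfolding w_def using L by simp
  have wr: "w \<le> r" unfolding w_def r_def using L by simp
  have \<kappa>: "0 < \<kappa>" "\<kappa> \<le> 1"
    unfolding \<kappa>_def using \<epsilon> by (auto simp: power_le_one)
  have K: "K * \<kappa> = r * w * L"
  proof -
    have "K * \<kappa> = \<epsilon> ^ 3 * lam * S" unfolding K_def \<kappa>_def by (simp add: power2_eq_square power3_eq_cube)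
    then show ?thesis using \<epsilon>(4) unfolding r_def w_def by simp
  qed
  have K': "K = r * w * L / \<kappa>" using K \<kappa> by (simp add: field_simps)
  \<comment> \<open>Lets the polynomial factor \<open>M\<close> be absorbed in
    \<open>exp (4 * K)\<close> below.\<close>
  have Kr: "r \<le> K"
  proof -
    have "1 \<le> w * L" using mult_mono[of 1 w 1 L] w L by simp
    then have "r * 1 \<le> r * (w * L)" using r by (intro mult_left_mono) auto
    also have "\<dots> = K * \<kappa>" using K by simp
    also have "\<dots> \<le> K * 1" unfolding K' using \<kappa> r w L by (intro mult_left_mono) auto
    finally show ?thesis by simp
  qed
  have rw: "1 \<le> r / w" using wr w by simp
  have q: "r / w \<le> real q" "real q \<le> r / w + 1" "0 < q"
    unfolding q_def using rw by linarith+
  \<comment> \<open>As \<open>r / w = r * w / L\<close>, the bound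
    \<open>m * L \<le> s1\<^sup>2\<close> and \<open>2 \<le> L\<close> make this at most
    \<open>s1 / 2\<close>; rounding up stays within \<open>s1\<close> because
    \<open>2 \<le> s1\<close>.\<close>
  have qs1: "q \<le> s1"
  proof -
    have "(r * w)\<^sup>2 \<le> (real s1)\<^sup>2"
      using L(4) by (simp add: power2_eq_square) (metis mult.assoc mult.commute r2 w2)
    then have "r * w \<le> real s1" by (rule power2_le_imp_le) simp
    then have "r * w / L \<le> real s1 / 2" using L by (intro frac_le) auto
    moreover have "r * w / L = r / w" unfolding w2[symmetric] using w by simp
    ultimately have "real q \<le> real s1 / 2 + 1" using q by linarith
    then show ?thesis using s by linarith
  qed
  have T: "1 \<le> T" "T \<le> 2 * real m"
  proof -
    have "\<epsilon> * real m \<le> 1 / 256 * real m" using \<epsilon> by (intro mult_right_mono) auto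
    then show "1 \<le> T" "T \<le> 2 * real m" unfolding T_def using \<epsilon> m4 by auto
  qed
  note \<beta>T = subgroup_beta_bounds[OF T(1), where 'a = 'a, folded \<beta>[folded T_def]]
  have M: "M \<le> M'" unfolding M_def M'_def by (rule le_nat_floor) (use \<epsilon> in simp)
  have M': "real M' \<le> real M + 16 * (\<epsilon> * real m)"
    unfolding M_def M'_def using \<epsilon> by (subst of_nat_nat) auto
  have terminal: "real (card (configs s1 s2 m A B1 B2)) \<le> Q"
    if A: "finite A" and B: "B1 \<subseteq> F1" "B2 \<subseteq> F2" and ne: "configs s1 s2 m A B1 B2 \<noteq> {}"
      and ter: "real (card B1) \<le> real m / 2 \<and> real (card B2) \<le> real m / 2
        \<or> real (card (missed_pairs A B1 B2)) \<le> 3 * \<kappa> * real (card B1) * real (card B2)" for A B1 B2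
  proof -
    have fin: "finite B1" "finite B2" using B F finite_subset by auto
    note bd = configs_nonempty_bounds[OF ne fin]
    have "real (card B1) + real (card B2) \<le> real m + real \<beta> + 16 * (\<epsilon> * real m)"
      using ter
    proof
      assume "real (card B1) \<le> real m / 2 \<and> real (card B2) \<le> real m / 2"
      then show ?thesis using \<epsilon> by linarith
    next
      assume few: "real (card (missed_pairs A B1 B2)) \<le> 3 * \<kappa> * real (card B1) * real (card B2)"
      have "3 * \<kappa> * real (card B1) * real (card B2) \<le> 4 * \<kappa> * real (card B1) * real (card B2)"
        using \<kappa> by (intro mult_right_mono) auto
      also have "\<dots> = (2 * \<epsilon>)\<^sup>2 * real (card B1) * real (card B2)" unfolding \<kappa>_def by simp
      finally have "real (card (missed_pairs A B1 B2)) \<le> (2 * \<epsilon>)\<^sup>2 * real (card B1) * real (card B2)"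
        using few by linarith
      then have "real (card B1) + real (card B2) \<le> real m + real \<beta> + 8 * (2 * \<epsilon>) * real m"
        by (intro card_add_le_if_few_missed[of T \<beta> "real m" "2 * \<epsilon>" A B1 B2])
          (use \<beta>T T \<epsilon> A fin bd s in \<open>auto simp: T_def\<close>)
      then show ?thesis by simp
    qed
    then have "card B1 + card B2 \<le> M'" unfolding M'_def by (intro le_nat_floor) simp
    then show ?thesis unfolding Q_def using card_configs_le_choose[OF fin] by (simp add: of_nat_mono)
  qed
  define G where "G = ((real s1 * (real m + real \<beta>) / S) gchoose s1) * ((real s2 * (real m + real \<beta>) / S) gchoose s2)"
  have c3: "real (M choose (s1 + s2)) \<le> real M * G"
    using choose_le_gchoose_mult_gchoose[of s1 s2 M] s m unfolding G_def M_def S by (simp add: mult.assoc)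
  have Mpos: "0 < real M" unfolding M_def using m4 by simp
  \<comment> \<open>Positivity of the integer coefficient yields \<open>0 \<le> G\<close> without
    inspecting the generalized ones.\<close>
  have "0 < real (M choose (s1 + s2))" using m unfolding M_def by simp
  then have G: "0 \<le> G" using c3 Mpos by (smt (verit) mult_pos_neg)
  show ?thesis
  proof (cases "configs s1 s2 m {} F1 F2 = {}")
    case True
    then show ?thesis using G unfolding G_def by (simp add: mult.assoc)
  next
    case False
    have pot: "potential (real m / 2) m {} F1 F2 = 2 * L + 2"
      unfolding potential_def using F L m4 by simp
    have "2 / \<kappa> * (2 * L + 2) \<le> real k" unfolding k_def by linarith
    then have k: "2 * L + 2 \<le> \<kappa> / 2 * real k" using \<kappa> by (simp add: field_simps)
    have k': "real k \<le> 2 / \<kappa> * (2 * L + 2) + 1"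
      unfolding k_def using \<kappa> L by (simp add: of_nat_ceiling)
    have "real (card (configs s1 s2 m {} F1 F2))
      \<le> Q * N powr ((real q + 1) * (real k + 1) + 2 * (real m - real (card ({} :: 'a set))) / (\<kappa> * real q))"
      by (rule container_count[where ?F1.0 = F1 and ?F2.0 = F2 and \<mu> = "real m / 2"])
        (use terminal F N_def Q_def \<kappa> q qs1 s m4 False pot k in auto)
    also have "N powr ((real q + 1) * (real k + 1) + 2 * (real m - real (card ({} :: 'a set))) / (\<kappa> * real q))
      \<le> exp (46 * K)"
    proof -
      let ?x = "(real q + 1) * (real k + 1) + 2 * real m / (\<kappa> * real q)"
      have "real k + 1 \<le> (4 * L + 4) / \<kappa> + 2" using k' by (simp add: algebra_simps add_divide_distrib)
      also have "2 \<le> 2 / \<kappa>" using \<kappa> by (simp add: field_simps)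
      also have "(4 * L + 4) / \<kappa> + 2 / \<kappa> = (4 * L + 6) / \<kappa>" by (simp add: add_divide_distrib)
      also have "\<dots> \<le> 7 * L / \<kappa>" using \<kappa> L by (intro divide_right_mono) auto
      finally have k1: "real k + 1 \<le> 7 * L / \<kappa>" by simp
      have "real q + 1 \<le> 3 * (r / w)" using q rw by linarith
      then have "(real q + 1) * (real k + 1) \<le> 3 * (r / w) * (7 * L / \<kappa>)"
        using k1 rw by (intro mult_mono) auto
      also have "\<dots> = 21 * (r * w) / \<kappa>" unfolding w2[symmetric] using w by simp
      finally have x1: "(real q + 1) * (real k + 1) \<le> 21 * (r * w) / \<kappa>" .
      have "2 * real m / (\<kappa> * real q) \<le> 2 * real m / (\<kappa> * (r / w))"
        using q \<kappa> rw by (intro divide_left_mono mult_left_mono mult_pos_pos) auto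
      also have "\<dots> = 2 * (r * w) / \<kappa>" unfolding r2[symmetric] using r w \<kappa> by (simp add: field_simps)
      finally have "2 * real m / (\<kappa> * real q) \<le> 2 * (r * w) / \<kappa>" .
      with x1 have x: "?x \<le> 23 * (r * w) / \<kappa>" by (simp add: add_divide_distrib[symmetric])
      have x0: "0 \<le> ?x" using \<kappa> by (intro add_nonneg_nonneg) auto
      have "N \<le> (real n)\<^sup>2"
      proof -
        have "2 * real n + 4 \<le> 4 * real n" using n by simp
        also have "\<dots> \<le> real n * real n" using n by (intro mult_right_mono) auto
        finally show ?thesis unfolding N_def by (simp add: power2_eq_square)
      qed
      then have "ln N \<le> ln ((real n)\<^sup>2)" unfolding N_def using n by (subst ln_le_cancel_iff) auto
      also have "\<dots> = 2 * L" unfolding L(1) using n by (simp add: ln_realpow)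
      finally have lnN: "ln N \<le> 2 * L" .
      have "?x * ln N \<le> (23 * (r * w) / \<kappa>) * (2 * L)"
        using x lnN x0 L r w \<kappa> N_def n by (intro mult_mono) auto
      also have "\<dots> = 46 * K" unfolding K' by simp
      finally have "?x * ln N \<le> 46 * K" .
      moreover have "N powr ?x = exp (?x * ln N)" unfolding powr_def N_def using n by simp
      ultimately show ?thesis by simp
    qed
    finally have c1: "real (card (configs s1 s2 m {} F1 F2)) \<le> Q * exp (46 * K)"
      using Q_def by (simp add: mult_left_mono)
    have Sn: "S = real (s1 + s2)" unfolding S by simp
    have sum: "real m * (\<Sum>i<s1 + s2. 1 / (real M - real i)) \<le> 4 * S * lam"
      unfolding lam Sn by (rule sum_inverse_le_lambda) (use s m lnS Sn M_def in auto)
    have "Q \<le> exp ((real M' - real M) * (\<Sum>i<s1 + s2. 1 / (real M - real i))) * real (M choose (s1 + s2))"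
      unfolding Q_def by (rule choose_le_exp_mult_choose) (use m M M_def in auto)
    also have "\<dots> \<le> exp (64 * K) * real (M choose (s1 + s2))"
    proof -
      have "(real M' - real M) * (\<Sum>i<s1 + s2. 1 / (real M - real i))
          \<le> 16 * (\<epsilon> * real m) * (\<Sum>i<s1 + s2. 1 / (real M - real i))"
        using M' m by (intro mult_right_mono sum_nonneg) (auto simp: M_def)
      also have "\<dots> = 16 * \<epsilon> * (real m * (\<Sum>i<s1 + s2. 1 / (real M - real i)))" by simp
      also have "\<dots> \<le> 16 * \<epsilon> * (4 * S * lam)" using sum \<epsilon> by (intro mult_left_mono) auto
      also have "\<dots> = 64 * K" unfolding K_def by simp
      finally show ?thesis by (simp add: mult_right_mono)
    qed
    finally have c2: "Q \<le> exp (64 * K) * real (M choose (s1 + s2))" .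
    have "real M \<le> exp (4 * K)"
    proof -
      have "real M \<le> 3 * real m" unfolding M_def using \<beta>T(2) T by simp
      also have "\<dots> \<le> exp 2 * exp (2 * r)"
      proof (rule mult_mono)
        show "(3 :: real) \<le> exp 2" using exp_ge_add_one_self[of 2] by simp
        have "r \<le> exp r" using exp_ge_add_one_self[of r] by linarith
        then have "r * r \<le> exp r * exp r" using r by (intro mult_mono) auto
        then show "real m \<le> exp (2 * r)" unfolding r2 by (simp add: exp_add[symmetric])
      qed auto
      also have "\<dots> = exp (2 + 2 * r)" by (simp add: exp_add)
      also have "\<dots> \<le> exp (4 * K)" using Kr r by simp
      finally show ?thesis .
    qed
    then have c4: "real M * G \<le> exp (4 * K) * G" using G by (rule mult_right_mono)
    have "real (card (configs s1 s2 m {} F1 F2)) \<le> (exp (64 * K) * (exp (4 * K) * G)) * exp (46 * K)"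
      using c1 c2 c3 c4 by (meson exp_ge_zero mult_left_mono mult_right_mono order_trans)
    also have "\<dots> = exp (64 * K + 4 * K + 46 * K) * G" by (simp only: exp_add mult_ac)
    also have "\<dots> \<le> exp (1024 * K) * G" using Kr r G by (intro mult_right_mono) auto
    finally show ?thesis unfolding K_def G_def by (simp add: mult_ac)
  qed
qed

theorem theorem4p3:
  fixes s1 s2 n m \<beta> :: nat and lam :: real and F1 F2 :: "'a::ab_group_add set"
  assumes "s2 \<ge> s1"
    and "real s1 \<ge> max (sqrt ((real s1 + real s2) * ln (real n)))
                        (2 ^ 48 * ln (real n) ^ 3 - real s2)"
    and "s1 + s2 \<le> m"
    and "real m \<le> min (real s1 ^ 2 / ln (real n))
                       ((real s1 + real s2) ^ 2 / (2 ^ 48 * ln (real n) ^ 3))"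
    and "lam = lambda_param s1 s2 m"
    and "\<beta> = subgroup_beta TYPE('a)
               (real m + 2 ^ 8 * real m powr (7/6) * (real s1 + real s2) powr (-1/3)
                           * lam powr (-1/3) * sqrt (ln (real n)))"
    and "finite F1" and "finite F2" and "card F1 = n" and "card F2 = n"
  shows "real (card {(X1, X2). X1 \<subseteq> F1 \<and> X2 \<subseteq> F2 \<and> card X1 = s1 \<and> card X2 = s2
                                \<and> card (X1 + X2) \<le> m})
         \<le> exp (2 ^ 10 * real m powr (1/6) * (real s1 + real s2) powr (2/3)
                  * lam powr (2/3) * sqrt (ln (real n)))
           * ((real s1 * (real m + real \<beta>) / (real s1 + real s2)) gchoose s1)
           * ((real s2 * (real m + real \<beta>) / (real s1 + real s2)) gchoose s2)"
proof -
  define L where "L = ln (real n)"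
  define S where "S = real s1 + real s2"
  have configs: "{(X1, X2). X1 \<subseteq> F1 \<and> X2 \<subseteq> F2 \<and> card X1 = s1 \<and> card X2 = s2 \<and> card (X1 + X2) \<le> m}
      = configs s1 s2 m {} F1 F2"
    unfolding configs_def by simp
  show ?thesis
  proof (cases "n \<le> 1")
    case True
    \<comment> \<open>Division by \<open>L = 0\<close> yields 0, so the upper bound on
      \<open>m\<close> forces \<open>m = 0\<close>, and both sizes vanish. The case
      \<open>n = 0\<close> is included, as \<open>ln 0 = 0\<close>.\<close>
    then have "L = 0" unfolding L_def by (cases n) auto
    then have "m = 0" using assms(4) unfolding L_def by simp
    then have zero: "m = 0" "s1 = 0" "s2 = 0" using assms(3) by auto
    have "card (configs s1 s2 m {} F1 F2) \<le> (n + n) choose (s1 + s2)"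
      by (rule card_configs_le_choose) (use assms in auto)
    then show ?thesis unfolding configs using zero by simp
  next
    case False
    have half: "1 / 2 \<le> ln (2 :: real)" using exp_half_le2 by (subst ln_ge_iff) auto
    have "ln 2 \<le> L" unfolding L_def using False by (subst ln_le_cancel_iff) auto
    then have L: "1 / 2 \<le> L" using half by linarith
    have L0: "0 < L" "0 < L ^ 3" using L by auto
    have h1: "sqrt (S * L) \<le> real s1" and h2: "2 ^ 48 * L ^ 3 \<le> S"
      and h3: "real m \<le> (real s1)\<^sup>2 / L" and h4: "real m \<le> S\<^sup>2 / (2 ^ 48 * L ^ 3)"
      using assms(2,4) unfolding L_def S_def by auto
    have mS: "S \<le> real m" using assms(3) unfolding S_def by linarith
    have "(1 / 2) ^ 3 \<le> L ^ 3" using L by (intro power_mono) auto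
    then have S45: "2 ^ 45 \<le> S" using h2 by (simp add: power3_eq_cube)
    have Mge: "1 \<le> (real m + real \<beta>) / S" using mS S45 by simp
    show ?thesis
    proof (cases "s2 \<le> n")
      case s2n: False
      \<comment> \<open>\<open>F2\<close> is too small when \<open>s2 > n\<close>. In the other case
        \<open>S \<le> 2 * n\<close> makes \<open>n\<close> large, which gives
        \<open>2 \<le> L\<close>.\<close>
      have "configs s1 s2 m {} F1 F2 = {}"
        using configs_nonempty_bounds(2)[of s1 s2 m "{}" F1 F2] assms(7-10) s2n by auto
      then show ?thesis
        using one_le_gbinomial[OF Mge, of s1] one_le_gbinomial[OF Mge, of s2]
        unfolding configs S_def by simp
    next
      case s2n: True
      have n9: "9 \<le> n"
      proof -
        have "S \<le> 2 * real n" unfolding S_def using assms(1) s2n by simp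
        then have "9 \<le> real n" using S45 by simp
        then show ?thesis by simp
      qed
      have exp1: "exp 1 \<le> (3 :: real)" by (rule exp_le)
      have L2: "2 \<le> L"
      proof -
        have "exp (2 :: real) = exp 1 * exp 1" by (simp add: exp_add[symmetric])
        also have "\<dots> \<le> 3 * 3" using exp1 by (intro mult_mono) auto
        also have "\<dots> \<le> real n" using n9 by simp
        finally show ?thesis unfolding L_def using n9 by (subst ln_ge_iff) auto
      qed
      have s1: "2 \<le> s1"
      proof -
        have "2 * 2 \<le> S * L" using S45 L2 by (intro mult_mono) auto
        then have "sqrt (2 * 2) \<le> sqrt (S * L)" by (rule real_sqrt_le_mono)
        then have "2 \<le> real s1" using h1 by simp
        then show ?thesis by simp
      qed
      have lnS: "1 \<le> ln S" using exp1 S45 by (subst ln_ge_iff) auto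
      have lam_eq: "lam = (if real m = S then ln S else min (real m / (real m - S)) (ln S))"
        using assms(3) unfolding assms(5) lambda_param_def S_def by (auto simp: diff_diff_eq)
      have lam1: "1 \<le> lam" unfolding lam_eq using lnS mS S45 by (auto simp: pos_le_divide_eq)
      have "lam \<le> ln S" unfolding lam_eq by simp
      then have lamS: "lam \<le> S" using ln_le_minus_one[of S] S45 by simp
      have L3: "L \<le> L ^ 3"
        using L2 self_le_power[of L 3] by simp
      have "1 * L ^ 3 \<le> 2 ^ 48 * L ^ 3" using L0 by (intro mult_right_mono) auto
      then have Lm: "L \<le> real m" using L3 h2 mS by linarith
      have m1: "1 \<le> real m" using mS S45 by simp
      \<comment> \<open>Chosen so that \<open>256 * (\<epsilon> * m)\<close> is the increment inside
        \<open>\<beta>\<close> and \<open>1024 * (\<epsilon> * lam * S)\<close> is the exponent of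
        the claim.\<close>
      define \<epsilon> where "\<epsilon> = real m powr (1/6) * S powr (-1/3) * lam powr (-1/3) * sqrt L"
      have \<epsilon>0: "0 < \<epsilon>" unfolding \<epsilon>_def using m1 S45 lam1 L0 by simp
      have cube: "\<epsilon> ^ 3 * lam * S = sqrt (real m) * L * sqrt L"
      proof -
        have "(real m powr (1/6)) ^ 3 = sqrt (real m)"
          using m1 by (simp add: powr_power powr_half_sqrt)
        moreover have inv: "(x powr (-1/3)) ^ 3 = 1 / x" if "1 \<le> x" for x :: real
          using that powr_minus_divide[of x 1] by (simp add: powr_power del: powr_minus_divide)
        then have "(S powr (-1/3)) ^ 3 = 1 / S" "(lam powr (-1/3)) ^ 3 = 1 / lam"
          using S45 lam1 by auto
        moreover have "sqrt L ^ 3 = L * sqrt L" using L0 by (simp add: power3_eq_cube)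
        ultimately have "\<epsilon> ^ 3 = sqrt (real m) * (1 / S) * (1 / lam) * (L * sqrt L)"
          unfolding \<epsilon>_def power_mult_distrib by simp
        then show ?thesis using S45 lam1 by simp
      qed
      have sq: "(sqrt (real m) * L * sqrt L)\<^sup>2 = real m * L ^ 3"
        using L0 by (simp add: power_mult_distrib) (simp add: power2_eq_square power3_eq_cube)
      \<comment> \<open>The constant \<open>2 ^ 48\<close> in the upper bound on \<open>m\<close>
        enters here: it gives \<open>\<epsilon> ^ 3 * S \<le> S / 2 ^ 24\<close>, and
        \<open>2 ^ 24 = 256 ^ 3\<close>.\<close>
      have \<epsilon>1: "\<epsilon> \<le> 1 / 256"
      proof -
        have "\<epsilon> ^ 3 * 1 * S \<le> \<epsilon> ^ 3 * lam * S"
          using lam1 \<epsilon>0 S45 by (intro mult_right_mono mult_left_mono) auto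
        then have "\<epsilon> ^ 3 * S \<le> sqrt (real m) * L * sqrt L" using cube by simp
        then have "(\<epsilon> ^ 3 * S)\<^sup>2 \<le> (sqrt (real m) * L * sqrt L)\<^sup>2"
          using \<epsilon>0 S45 by (intro power_mono) auto
        also have "\<dots> \<le> (S / 2 ^ 24)\<^sup>2"
        proof -
          have "real m * (2 ^ 48 * L ^ 3) \<le> S\<^sup>2"
            using h4 L0 pos_le_divide_eq[of "2 ^ 48 * L ^ 3" "real m" "S\<^sup>2"] by simp
          then have "real m * L ^ 3 \<le> S\<^sup>2 / 2 ^ 48"
            using pos_le_divide_eq[of "2 ^ 48" "real m * L ^ 3" "S\<^sup>2"] by (simp add: mult_ac)
          then show ?thesis unfolding sq by (simp add: power_divide)
        qed
        finally have "\<epsilon> ^ 3 * S \<le> S / 2 ^ 24" by (rule power2_le_imp_le) (use S45 in simp)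
        then have "\<epsilon> ^ 3 * S \<le> (1 / 256) ^ 3 * S" by (simp add: power_divide)
        then have "\<epsilon> ^ 3 \<le> (1 / 256) ^ 3" by (rule mult_right_le_imp_le) (use S45 in simp)
        then show ?thesis by (rule power_le_imp_le_base[where n = 2, simplified]) simp
      qed
      \<comment> \<open>The cube of the right side is at least
        \<open>\<epsilon> ^ 3 * lam * S\<close>, since \<open>lam\<close> and \<open>S\<close> are
        at most \<open>m\<close>, and the latter is at least 1 by \<open>cube\<close>.\<close>
      have \<epsilon>m: "1 \<le> \<epsilon> * real m"
      proof -
        have "1 * 1 * 1 \<le> sqrt (real m) * L * sqrt L" using m1 L2 by (intro mult_mono) auto
        also have "\<dots> = \<epsilon> ^ 3 * (lam * S)" using cube by simp
        also have "\<dots> \<le> \<epsilon> ^ 3 * (real m * (real m * real m))"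
        proof (intro mult_left_mono)
          have "lam * S \<le> real m * (real m * 1)" using lamS mS lam1 S45 by (intro mult_mono) auto
          also have "\<dots> \<le> real m * (real m * real m)" using m1 by (intro mult_left_mono) auto
          finally show "lam * S \<le> real m * (real m * real m)" .
        qed (use \<epsilon>0 in simp)
        also have "\<dots> = (\<epsilon> * real m) ^ 3" by (simp add: power_mult_distrib power3_eq_cube)
        finally have "1 ^ 3 \<le> (\<epsilon> * real m) ^ 3" by simp
        then show ?thesis by (rule power_le_imp_le_base[where n = 2, simplified]) (use \<epsilon>0 in simp)
      qed
      have split76: "real m powr (7/6) = real m powr (1/6) * real m"
        using m1 powr_add[of "real m" "1/6" 1] by simp
      have split23: "x powr (2/3) = x powr (-1/3) * x" if "1 \<le> x" for x :: real
        using that powr_add[of x "-1/3" 1] by simp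
      have \<beta>: "\<beta> = subgroup_beta TYPE('a) (real m + 256 * (\<epsilon> * real m))"
        unfolding assms(6) \<epsilon>_def S_def[symmetric] L_def[symmetric] split76 by (simp add: mult_ac)
      have "real (card (configs s1 s2 m {} F1 F2))
        \<le> exp (1024 * (\<epsilon> * lam * S))
          * ((real s1 * (real m + real \<beta>) / S) gchoose s1)
          * ((real s2 * (real m + real \<beta>) / S) gchoose s2)"
      proof (rule counting_bound[OF s1 assms(1) S_def assms(3) L_def L2 Lm _ _ lnS assms(5)
            \<epsilon>0 \<epsilon>1 \<epsilon>m cube \<beta> assms(7-10)])
        show "real m * L \<le> (real s1)\<^sup>2" using h3 L0 by (simp add: field_simps)
        show "4 \<le> n" using n9 by simp
      qed
      moreover have "1024 * (\<epsilon> * lam * S)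
          = 2 ^ 10 * real m powr (1/6) * S powr (2/3) * lam powr (2/3) * sqrt L"
        using split23[of S] split23[OF lam1] S45 unfolding \<epsilon>_def by simp
      ultimately show ?thesis unfolding configs S_def L_def by simp
    qed
  qed
qed

end
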